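(* Let $T$ be an ergodic measure-preserving automorphism of a Lebesgue space $(X,\mu)$ satisfying Condition H with $T$-invariant ergodic equivalence relation $\chi$, polymorphism $\Pi=\Phi\cdot T$ and dense limit polymorphisms $\Lambda=\lim_{n\to\infty}\Pi^n T^{-n}$ and $\Gamma=\lim_{n\to\infty}T^{-n}\Pi^n$ (as described in the context). Then $$\Pi\cdot\Lambda=\Lambda\cdot T\qquad\text{and}\qquad \Gamma\cdot\Pi=T\cdot\Gamma .$$ If these relations hold, then the automorphism $T$ is quasi-similar to the polymorphism $\Pi$.
   Context: $(X,\mu)$ is a Lebesgue space with continuous probability measure. A polymorphism $\Pi$ of $(X,\mu)$ (with invariant measure) is given by a bistochastic measure $\nu$ on $X\times X$, i.e. both coordinate projections of $\nu$ equal $\mu$. Its value (image) at $x$ is the conditional measure $\nu^x$ of $\nu$ on $\{x\}\times X$, regarded as a measure on $X$ (defined for $\mu$-a.e. $x$). Polymorphisms are considered mod $0$. The conjugate $\Pi^*$ has as its bistochastic measure the image of $\nu$ under $(x,y)\mapsto(y,x)$. The product $\Pi_1\Pi_2$ is defined by $\nu^x(A)=\int \nu_1^y(A)\,d\nu_2^x(y)$ (apply $\Pi_2$ first). A measure-preserving automorphism $T$ is regarded as the polymorphism with $\nu^x=\delta_{Tx}$. Limits of polymorphisms are in the weak topology: $\Pi_n\to\Pi$ iff $\nu_n(A\times B)\to\nu(A\times B)$ for all measurable $A,B\subset X$ (equivalently, weak operator convergence in $L^2(\mu)$ of the Markov operators $(V_\Pi f)(x)=\int f\,d\nu^x$). A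 polymorphism $\Pi$ is semi-dense if the only $f\in L^2(X,\mu)$ with $\int f(y)\,d\nu^x(y)=0$ for $\mu$-a.e. $x$ is $f=0$; it is dense if both $\Pi$ and $\Pi^*$ are semi-dense. It is nondegenerate if for a.e. $x$ the measure $\nu^x$ is not a delta-measure. An equivalence relation $\chi$ on $(X,\mu)$ is $T$-invariant if $x\,\chi\,y\iff Tx\,\chi\,Ty$ (mod $0$), and ergodic if every measurable set that is a union of $\chi$-classes has measure $0$ or $1$. A polymorphism is associated with $\chi$ if $\nu^x(\chi(x))=1$ for a.e. $x$, where $\chi(x)$ is the class of $x$. Condition H for $T$: there exist a $T$-invariant ergodic equivalence relation $\chi$ and a polymorphism $\Pi=\Phi\cdot T$, where $\Phi$ is a nondegenerate polymorphism associated with $\chi$, such that the weak limits $\Lambda=\lim_{n\to\infty}\Pi^nT^{-n}$ and $\Gamma=\lim_{n\to\infty}T^{-n}\Pi^n$ exist and both $\Lambda$ and $\Gamma$ are dense. A polymorphism $\Pi$ is a quasi-image of a polymorphism $\Psi$ if there is a dense polymorphism $\Lambda$ with $\Lambda\Pi=\Psi\Lambda$; $\Pi$ and $\Psi$ are quasi-similar if each is a quasi-image of the other. *)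

theory Defs
  imports "HOL-Probability.Probability"
begin

text \<open>
  Lebesgue space with continuous probability measure: isomorphic mod 0 to the unit interval.
  The model is the interval with its Borel sigma-algebra rather than the completed one,
  since conditional measures are in general defined on Borel sets only (mod 0 this is no
  restriction). Measurable maps inverse to each other almost everywhere restrict to a
  bimeasurable bijection between sets of full measure.
\<close>

definition unit_interval :: "real measure" where
  "unit_interval = restrict_space lborel {0..1}"

definition lebesgue_space :: "'a measure \<Rightarrow> bool" where
  "lebesgue_space M \<longleftrightarrow> prob_space M \<and>
     (\<exists>f\<in>measurable M unit_interval. \<exists>g\<in>measurable unit_interval M.
        distr M unit_interval f = unit_interval \<and>
        (AE x in M. g (f x) = x) \<and> (AE u in unit_interval. f (g u) = u))"

definition inverse_mod0 :: "'a measure \<Rightarrow> ('a \<Rightarrow> 'a) \<Rightarrow> ('a \<Rightarrow> 'a) \<Rightarrow> bool" where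
  "inverse_mod0 M T S \<longleftrightarrow>
     S \<in> measurable M M \<and> (AE x in M. S (T x) = x) \<and> (AE x in M. T (S x) = x)"

definition automorphism :: "'a measure \<Rightarrow> ('a \<Rightarrow> 'a) \<Rightarrow> bool" where
  "automorphism M T \<longleftrightarrow>
     T \<in> measurable M M \<and> distr M M T = M \<and> (\<exists>S. inverse_mod0 M T S)"

definition aut_inv :: "'a measure \<Rightarrow> ('a \<Rightarrow> 'a) \<Rightarrow> 'a \<Rightarrow> 'a" where
  "aut_inv M T = (SOME S. inverse_mod0 M T S)"

definition ergodic_map :: "'a measure \<Rightarrow> ('a \<Rightarrow> 'a) \<Rightarrow> bool" where
  "ergodic_map M T \<longleftrightarrow>
     (\<forall>A\<in>sets M. T -` A \<inter> space M = A \<longrightarrow> emeasure M A = 0 \<or> emeasure M A = 1)"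

text \<open>
  A polymorphism is represented by its bistochastic measure; equality of polymorphisms mod 0
  is then equality of measures.
\<close>

definition polymorphism :: "'a measure \<Rightarrow> ('a \<times> 'a) measure \<Rightarrow> bool" where
  "polymorphism M \<nu> \<longleftrightarrow>
     sets \<nu> = sets (M \<Otimes>\<^sub>M M) \<and> distr \<nu> M fst = M \<and> distr \<nu> M snd = M"

definition conditional_system :: "'a measure \<Rightarrow> ('a \<times> 'a) measure \<Rightarrow> ('a \<Rightarrow> 'a measure) \<Rightarrow> bool" where
  "conditional_system M \<nu> K \<longleftrightarrow>
     K \<in> measurable M (prob_algebra M) \<and>
     (\<forall>A\<in>sets M. \<forall>B\<in>sets M. emeasure \<nu> (A \<times> B) = (\<integral>\<^sup>+x\<in>A. emeasure (K x) B \<partial>M))"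

text \<open>
  \<open>cond_measure M \<nu> x\<close> is the value of the polymorphism at x. On a Lebesgue space a conditional system
  exists for every polymorphism and is unique up to a null set of points x, and every notion
  below depends only on its equivalence class mod 0.
\<close>

definition cond_measure :: "'a measure \<Rightarrow> ('a \<times> 'a) measure \<Rightarrow> 'a \<Rightarrow> 'a measure" where
  "cond_measure M \<nu> = (SOME K. conditional_system M \<nu> K)"

text \<open>The measure on the square with first marginal M and conditional measures K.\<close>

definition poly_of_kernel :: "'a measure \<Rightarrow> ('a \<Rightarrow> 'a measure) \<Rightarrow> ('a \<times> 'a) measure" where
  "poly_of_kernel M K =
     Giry_Monad.bind M (\<lambda>x. Giry_Monad.bind (K x) (\<lambda>y. return (M \<Otimes>\<^sub>M M) (x, y)))"

definition poly_of_map :: "'a measure \<Rightarrow> ('a \<Rightarrow> 'a) \<Rightarrow> ('a \<times> 'a) measure" where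
  "poly_of_map M T = poly_of_kernel M (\<lambda>x. return M (T x))"

definition conjugate :: "'a measure \<Rightarrow> ('a \<times> 'a) measure \<Rightarrow> ('a \<times> 'a) measure" where
  "conjugate M \<nu> = distr \<nu> (M \<Otimes>\<^sub>M M) (\<lambda>(x, y). (y, x))"

text \<open>The right factor is applied first.\<close>

definition poly_prod ::
  "'a measure \<Rightarrow> ('a \<times> 'a) measure \<Rightarrow> ('a \<times> 'a) measure \<Rightarrow> ('a \<times> 'a) measure" where
  "poly_prod M \<nu>\<^sub>1 \<nu>\<^sub>2 =
     poly_of_kernel M (\<lambda>x. Giry_Monad.bind (cond_measure M \<nu>\<^sub>2 x) (cond_measure M \<nu>\<^sub>1))"

primrec poly_power :: "'a measure \<Rightarrow> ('a \<times> 'a) measure \<Rightarrow> nat \<Rightarrow> ('a \<times> 'a) measure" where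
  "poly_power M \<nu> 0 = poly_of_map M (\<lambda>x. x)"
| "poly_power M \<nu> (Suc n) = poly_prod M \<nu> (poly_power M \<nu> n)"

definition weak_limit ::
  "'a measure \<Rightarrow> (nat \<Rightarrow> ('a \<times> 'a) measure) \<Rightarrow> ('a \<times> 'a) measure \<Rightarrow> bool" where
  "weak_limit M \<nu>s \<nu> \<longleftrightarrow> polymorphism M \<nu> \<and>
     (\<forall>A\<in>sets M. \<forall>B\<in>sets M. (\<lambda>n. measure (\<nu>s n) (A \<times> B)) \<longlonglongrightarrow> measure \<nu> (A \<times> B))"

text \<open>Real-valued functions suffice: the integral acts separately on real and imaginary parts.\<close>

definition semi_dense :: "'a measure \<Rightarrow> ('a \<times> 'a) measure \<Rightarrow> bool" where
  "semi_dense M \<nu> \<longleftrightarrow>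
     (\<forall>f :: 'a \<Rightarrow> real. f \<in> borel_measurable M \<longrightarrow> integrable M (\<lambda>x. (f x)\<^sup>2) \<longrightarrow>
        (AE x in M. (\<integral>y. f y \<partial>cond_measure M \<nu> x) = 0) \<longrightarrow> (AE x in M. f x = 0))"

definition dense_poly :: "'a measure \<Rightarrow> ('a \<times> 'a) measure \<Rightarrow> bool" where
  "dense_poly M \<nu> \<longleftrightarrow> semi_dense M \<nu> \<and> semi_dense M (conjugate M \<nu>)"

definition nondegenerate :: "'a measure \<Rightarrow> ('a \<times> 'a) measure \<Rightarrow> bool" where
  "nondegenerate M \<nu> \<longleftrightarrow>
     (AE x in M. \<not> (\<exists>y\<in>space M. cond_measure M \<nu> x = return M y))"

text \<open>
  Invariance mod 0 is asked off one null set of points; a condition for almost every pair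
  would be void when the classes are null sets.
\<close>

definition invariant_rel :: "'a measure \<Rightarrow> ('a \<Rightarrow> 'a) \<Rightarrow> ('a \<times> 'a) set \<Rightarrow> bool" where
  "invariant_rel M T R \<longleftrightarrow>
     (\<exists>N\<in>null_sets M. \<forall>x\<in>space M - N. \<forall>y\<in>space M - N. (x, y) \<in> R \<longleftrightarrow> (T x, T y) \<in> R)"

text \<open>
  No measurability of the relation itself is required, so saturated sets and classes are
  measured in the completion; \<open>emeasure\<close> vanishes on non-measurable sets, hence the value 1
  in \<open>associated\<close> includes measurability of the class.
\<close>

definition ergodic_rel :: "'a measure \<Rightarrow> ('a \<times> 'a) set \<Rightarrow> bool" where
  "ergodic_rel M R \<longleftrightarrow>
     (\<forall>A\<in>sets (completion M). R `` A = A \<longrightarrow>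
        emeasure (completion M) A = 0 \<or> emeasure (completion M) A = 1)"

definition associated :: "'a measure \<Rightarrow> ('a \<times> 'a) set \<Rightarrow> ('a \<times> 'a) measure \<Rightarrow> bool" where
  "associated M R \<nu> \<longleftrightarrow>
     (AE x in M. emeasure (completion (cond_measure M \<nu> x)) (R `` {x}) = 1)"

definition quasi_image :: "'a measure \<Rightarrow> ('a \<times> 'a) measure \<Rightarrow> ('a \<times> 'a) measure \<Rightarrow> bool" where
  "quasi_image M \<pi> \<psi> \<longleftrightarrow>
     (\<exists>L. polymorphism M L \<and> dense_poly M L \<and> poly_prod M L \<pi> = poly_prod M \<psi> L)"

definition quasi_similar :: "'a measure \<Rightarrow> ('a \<times> 'a) measure \<Rightarrow> ('a \<times> 'a) measure \<Rightarrow> bool" where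
  "quasi_similar M \<pi> \<psi> \<longleftrightarrow> quasi_image M \<pi> \<psi> \<and> quasi_image M \<psi> \<pi>"

end

theory Submission
  imports Defs
begin

text \<open>
A polymorphism acts on functions by its Markov operator \<open>(V f)(x) = \<integral> f d\<nu>\<^sup>x\<close>, and products of
polymorphisms correspond to compositions of these operators in reverse order. Hence
polymorphisms form a monoid under the product (\<open>poly_prod_assoc\<close>), in which an automorphism
\<open>T\<close> is invertible (\<open>poly_prod_poly_of_map\<close>), with conjugation as an anti-automorphism
(\<open>conjugate_poly_prod\<close>).

The two relations are then formal. In the monoid,
\<open>P (P\<^sup>n T\<^bsup>-n\<^esup>) = (P\<^bsup>n+1\<^esup> T\<^bsup>-n-1\<^esup>) T\<close> and \<open>(T\<^bsup>-n\<^esup> P\<^sup>n) P = T (T\<^bsup>-n-1\<^esup> P\<^bsup>n+1\<^esup>)\<close>, and multiplication by a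
fixed polymorphism is weakly continuous (\<open>weak_limit_poly_prod_left\<close>,
\<open>weak_limit_poly_prod_right\<close>), so the limits satisfy \<open>P \<Lambda> = \<Lambda> T\<close> and \<open>\<Gamma> P = T \<Gamma>\<close>
(\<open>weak_limits_intertwine\<close>). As \<open>\<Lambda>\<close> and \<open>\<Gamma>\<close> are dense, the first relation exhibits \<open>T\<close> as a
quasi-image of \<open>P\<close> and the second exhibits \<open>P\<close> as a quasi-image of \<open>T\<close>.

The continuity rests on the fixed marginals: approximating a function of the second
variable in \<open>L\<^sup>1\<close> costs the same against every polymorphism (\<open>weak_limit_integral\<close>). Continuity
in the other factor follows by conjugation.

The analytic input is that conditional measures exist at all. On a Lebesgue space they are
built from conditional distribution functions on the unit interval
(\<open>lebesgue_space_disintegration\<close>). They are unique only almost everywhere, so every identity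
is verified on rectangles, where only the almost everywhere class of the Markov operator
enters (\<open>markov_AE_eqI\<close>).
\<close>

section \<open>Conditional measures on a Lebesgue space\<close>

context prob_space
begin

text \<open>
The conditional probability of one fixed event given the first coordinate is the
Radon-Nikodym derivative of \<open>A \<mapsto> \<rho> (A \<times> B)\<close>. It is determined only up to a null set
depending on \<open>B\<close>, so making it a measure in \<open>B\<close> takes the further work below.
\<close>

lemma ex_conditional_probability:
  assumes \<rho>: "sets \<rho> = sets (M \<Otimes>\<^sub>M N)" "distr \<rho> M fst = M" and B: "B \<in> sets N"
  shows "\<exists>h\<in>borel_measurable M. \<forall>A\<in>sets M. emeasure \<rho> (A \<times> B) = (\<integral>\<^sup>+x. h x * indicator A x \<partial>M)"
proof -
  have sp: "space \<rho> = space M \<times> space N"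
    using \<rho>(1) by (metis sets_eq_imp_space_eq space_pair_measure)
  have fst: "fst \<in> measurable \<rho> M"
    unfolding measurable_cong_sets[OF \<rho>(1) refl] by (rule measurable_fst)
  let ?I = "indicator (space M \<times> B) :: _ \<Rightarrow> ennreal"
  have I: "?I \<in> borel_measurable \<rho>"
    using B by (simp add: borel_measurable_indicator_iff \<rho>(1) sp sets.Int_space_eq2)
  define N' where "N' = distr (density \<rho> ?I) M fst"
  have N': "emeasure N' A = emeasure \<rho> (A \<times> B)" if A: "A \<in> sets M" for A
  proof -
    have *: "fst -` A \<inter> space \<rho> = A \<times> space N"
      using A sets.sets_into_space by (fastforce simp: sp)
    have "emeasure N' A = emeasure (density \<rho> ?I) (A \<times> space N)"
      using fst A by (simp add: N'_def emeasure_distr *)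
    also have "\<dots> = (\<integral>\<^sup>+z. ?I z * indicator (A \<times> space N) z \<partial>\<rho>)"
      using A I by (simp add: emeasure_density \<rho>(1))
    also have "\<dots> = (\<integral>\<^sup>+z. indicator (A \<times> B) z \<partial>\<rho>)"
      using sets.sets_into_space[OF A] sets.sets_into_space[OF B]
      by (intro nn_integral_cong) (auto simp: indicator_def)
    also have "\<dots> = emeasure \<rho> (A \<times> B)"
      using A B by (simp add: \<rho>(1))
    finally show ?thesis .
  qed
  have "absolutely_continuous M N'"
    unfolding absolutely_continuous_def
  proof
    fix A assume "A \<in> null_sets M"
    then have A: "A \<in> sets M" "emeasure (distr \<rho> M fst) A = 0" by (auto simp: \<rho>(2))
    have "fst -` A \<inter> space \<rho> = A \<times> space N"
      using A sets.sets_into_space by (fastforce simp: sp)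
    then have "emeasure \<rho> (A \<times> space N) = 0"
      using A fst by (simp add: emeasure_distr)
    moreover have "emeasure \<rho> (A \<times> B) \<le> emeasure \<rho> (A \<times> space N)"
      using A B sets.sets_into_space[OF B] by (intro emeasure_mono) (auto simp: \<rho>(1))
    ultimately show "A \<in> null_sets N'"
      using A N' by (auto simp: null_sets_def N'_def)
  qed
  then have "density M (RN_deriv M N') = N'"
    by (rule density_RN_deriv) (simp add: N'_def)
  then have "emeasure \<rho> (A \<times> B) = (\<integral>\<^sup>+x. RN_deriv M N' x * indicator A x \<partial>M)" if "A \<in> sets M" for A
    using that N'[OF that] emeasure_density[of "RN_deriv M N'" M A] by simp
  then show ?thesis
    by (intro bexI[of _ "RN_deriv M N'"] ballI borel_measurable_RN_deriv)
qed

lemma AE_eq_of_set_integrals: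
  fixes f g :: "'a \<Rightarrow> ennreal"
  assumes [measurable]: "f \<in> borel_measurable M" "g \<in> borel_measurable M"
    and eq: "\<And>A. A \<in> sets M \<Longrightarrow> (\<integral>\<^sup>+x. f x * indicator A x \<partial>M) = (\<integral>\<^sup>+x. g x * indicator A x \<partial>M)"
  shows "AE x in M. f x = g x"
  by (rule density_unique_finite_measure) (use eq in auto)

text \<open>
Conditional probabilities of half-lines are under control only for countably many
endpoints. The infimum over rational endpoints to the right turns such a rational family
into a distribution function, and the last claim says that its value at \<open>t\<close> is still the
limit of the given values, which is what lets integrals pass to it.
\<close>

lemma right_continuous_envelope:
  fixes h :: "rat \<Rightarrow> real"
  assumes "mono h" and "\<forall>q<0. h q = 0" and "\<forall>q\<ge>1. h q = 1"
  defines "F \<equiv> \<lambda>t::real. Inf (h ` {q. t < of_rat q})"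
  shows "\<And>s t. s \<le> t \<Longrightarrow> F s \<le> F t" and "\<And>a. continuous (at_right a) F"
    and "(F \<longlongrightarrow> 0) at_bot" and "(F \<longlongrightarrow> 1) at_top"
    and "\<And>t X. (\<And>n. t < of_rat (X n)) \<Longrightarrow> (\<lambda>n. of_rat (X n)) \<longlonglongrightarrow> t \<Longrightarrow> (\<lambda>n. h (X n)) \<longlonglongrightarrow> F t"
proof -
  have mono: "h q \<le> h r" if "q \<le> r" for q r
    using assms(1) that by (rule monoD)
  have zero: "h q = 0" if "q < 0" for q
    using assms(2) that by simp
  have one: "h q = 1" if "1 \<le> q" for q
    using assms(3) that by simp
  have h0: "0 \<le> h q" for q
    using mono[of "min q (-1)" q] zero[of "min q (-1)"] by simp
  have h1: "h q \<le> 1" for q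
    using mono[of q "max q 1"] one[of "max q 1"] by simp
  have bdd: "bdd_below (h ` X)" for X
    using h0 by (auto intro!: bdd_belowI)
  have ne: "\<exists>q. t < of_rat q" for t :: real
    using of_rat_dense[of t "t + 1"] by auto
  have le: "F t \<le> h q" if "t < of_rat q" for t q
    unfolding F_def using that by (intro cInf_lower bdd) auto
  have less: "\<exists>q. t < of_rat q \<and> h q < F t + e" if "0 < e" for t e
  proof -
    have "Inf (h ` {q. t < of_rat q}) < F t + e"
      using that by (simp add: F_def)
    then show ?thesis
      using ne[of t] bdd by (subst (asm) cInf_less_iff) auto
  qed
  show mF: "F s \<le> F t" if "s \<le> t" for s t
    unfolding F_def using that ne[of t] by (intro cInf_superset_mono bdd image_mono) auto
  show "continuous (at_right a) F" for a
  proof (subst continuous_at_right_real_increasing[OF mF], assumption, intro allI impI)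
    fix e :: real assume "0 < e"
    then obtain q where q: "a < of_rat q" "h q < F a + e" using less by blast
    have "F (a + (of_rat q - a) / 2) \<le> h q"
      using q by (intro le) (simp add: field_simps)
    then show "\<exists>d>0. F (a + d) - F a < e"
      using q by (intro exI[of _ "(of_rat q - a) / 2"]) auto
  qed
  have F0: "F t = 0" if "t < 0" for t
  proof -
    obtain q where q: "t < of_rat q" "of_rat q < (0::real)"
      using of_rat_dense[OF \<open>t < 0\<close>] by auto
    have "F t \<le> 0" using le[OF q(1)] zero q(2) by simp
    moreover have "0 \<le> F t"
      unfolding F_def using ne[of t] h0 by (intro cInf_greatest) auto
    ultimately show ?thesis by simp
  qed
  have F1: "F t = 1" if "1 \<le> t" for t
  proof -
    have "h q = 1" if "t < of_rat q" for q
    proof -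
      have "(1::real) < of_rat q" by (rule le_less_trans[OF \<open>1 \<le> t\<close> that])
      then show ?thesis by (intro one) simp
    qed
    then have "h ` {q. t < of_rat q} = {1}" using ne[of t] by auto
    then show ?thesis by (simp add: F_def)
  qed
  show "(F \<longlongrightarrow> 0) at_bot"
    by (rule tendsto_eventually) (auto simp: eventually_at_bot_dense F0 intro!: exI[of _ 0])
  show "(F \<longlongrightarrow> 1) at_top"
    by (rule tendsto_eventually) (auto simp: eventually_at_top_linorder F1 intro!: exI[of _ 1])
  show "(\<lambda>n. h (X n)) \<longlonglongrightarrow> F t" if X: "\<And>n. t < of_rat (X n)" "(\<lambda>n. of_rat (X n)) \<longlonglongrightarrow> t" for t X
  proof (rule order_tendstoI)
    fix a assume "a < F t"
    then show "\<forall>\<^sub>F n in sequentially. a < h (X n)"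
      by (intro always_eventually allI less_le_trans[OF _ le[OF X(1)]])
  next
    fix a assume "F t < a"
    then obtain q where q: "t < of_rat q" "h q < a"
      using less[of "a - F t" t] by auto
    show "\<forall>\<^sub>F n in sequentially. h (X n) < a"
      using order_tendstoD(2)[OF X(2) q(1)]
    proof eventually_elim
      case (elim n)
      then have "h (X n) \<le> h q" by (intro mono) (simp add: of_rat_less)
      then show ?case using q(2) by simp
    qed
  qed
qed

text \<open>
The second coordinate is real, so a conditional measure is a distribution function. The
countably many almost sure relations between conditional probabilities of rational
half-lines (monotonicity, the values 0 below and 1 above the interval) hold simultaneously
off one null set, where the right-continuous envelope defines the kernel. Half-lines
generate the Borel sets, which extends the integral formula from them to all \<open>B\<close>. The support
condition makes the limits of the distribution function at infinity trivial.
\<close>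

lemma disintegration_unit_interval:
  fixes \<rho> :: "('a \<times> real) measure"
  assumes \<rho>: "sets \<rho> = sets (M \<Otimes>\<^sub>M borel)" "distr \<rho> M fst = M"
    and supp: "emeasure \<rho> (space M \<times> (- {0..1})) = 0"
  shows "\<exists>K\<in>measurable M (prob_algebra borel). \<forall>A\<in>sets M. \<forall>B\<in>sets borel.
           emeasure \<rho> (A \<times> B) = (\<integral>\<^sup>+x\<in>A. emeasure (K x) B \<partial>M)"
proof -
  have sp: "space \<rho> = space M \<times> UNIV"
    using \<rho>(1) by (metis sets_eq_imp_space_eq space_pair_measure space_borel)
  have fst: "fst \<in> measurable \<rho> M"
    unfolding measurable_cong_sets[OF \<rho>(1) refl] by (rule measurable_fst)
  interpret r: prob_space \<rho>
    using prob_space_distrD[OF fst] prob_space_axioms by (simp add: \<rho>(2))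
  have times: "A \<times> B \<in> sets \<rho>" if "A \<in> sets M" "B \<in> sets borel" for A B
    using that by (simp add: \<rho>(1))
  have marg: "emeasure \<rho> (A \<times> UNIV) = emeasure M A" if A: "A \<in> sets M" for A
  proof -
    have "fst -` A \<inter> space \<rho> = A \<times> UNIV"
      using A sets.sets_into_space by (fastforce simp: sp)
    then show ?thesis
      using emeasure_distr[OF fst A] by (simp add: \<rho>(2))
  qed
  have null: "emeasure \<rho> (A \<times> B) = 0" if "A \<in> sets M" "B \<in> sets borel" "B \<subseteq> - {0..1}" for A B
  proof -
    have "emeasure \<rho> (A \<times> B) \<le> emeasure \<rho> (space M \<times> (- {0..1}))"
      using that sets.sets_into_space by (intro emeasure_mono times) auto
    then show ?thesis by (simp add: supp)
  qed
  have "\<forall>B\<in>sets borel. \<exists>h\<in>borel_measurable M. \<forall>A\<in>sets M. emeasure \<rho> (A \<times> B) = (\<integral>\<^sup>+x. h x * indicator A x \<partial>M)"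
    by (intro ballI ex_conditional_probability[OF \<rho>])
  then obtain c where cm: "\<And>B. B \<in> sets borel \<Longrightarrow> c B \<in> borel_measurable M"
    and c: "\<And>A B. A \<in> sets M \<Longrightarrow> B \<in> sets borel \<Longrightarrow> emeasure \<rho> (A \<times> B) = (\<integral>\<^sup>+x. c B x * indicator A x \<partial>M)"
    by metis
  define g where "g q = c {..of_rat q}" for q :: rat
  have gm[measurable]: "g q \<in> borel_measurable M" for q
    by (simp add: g_def cm)
  have g: "emeasure \<rho> (A \<times> {..of_rat q}) = (\<integral>\<^sup>+x. g q x * indicator A x \<partial>M)" if "A \<in> sets M" for A q
    using c[OF that] by (simp add: g_def)
  have mono: "AE x in M. g q x \<le> g r x" if "q \<le> r" for q r
  proof -
    let ?B = "{of_rat q<..of_rat r} :: real set"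
    have [measurable]: "c ?B \<in> borel_measurable M" by (simp add: cm)
    have "AE x in M. g r x = g q x + c ?B x"
    proof (rule AE_eq_of_set_integrals)
      fix A assume A[measurable]: "A \<in> sets M"
      have "{..of_rat r} = {..of_rat q} \<union> ?B"
        using that by (intro ivl_disj_un_one(3)[symmetric]) (simp add: of_rat_less_eq)
      then have "A \<times> {..of_rat r} = A \<times> {..of_rat q} \<union> A \<times> ?B"
        by (simp only: Sigma_Un_distrib2)
      then have "emeasure \<rho> (A \<times> {..of_rat r}) = emeasure \<rho> (A \<times> {..of_rat q}) + emeasure \<rho> (A \<times> ?B)"
        using A by (simp, subst plus_emeasure[symmetric]) (auto intro!: times)
      then show "(\<integral>\<^sup>+x. g r x * indicator A x \<partial>M) = (\<integral>\<^sup>+x. (g q x + c ?B x) * indicator A x \<partial>M)"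
        using A by (simp add: g c distrib_right nn_integral_add)
    qed measurable
    then show ?thesis by eventually_elim simp
  qed
  have outside: "b < 0 \<Longrightarrow> {..b} \<subseteq> - {0..1}" "1 \<le> b \<Longrightarrow> {b<..} \<subseteq> - {0..1}" for b :: real
    by auto
  have zero: "AE x in M. g q x = 0" if "q < 0" for q
  proof (rule AE_eq_of_set_integrals)
    fix A assume A: "A \<in> sets M"
    have "of_rat q < (0::real)" using that by simp
    then have "emeasure \<rho> (A \<times> {..of_rat q}) = 0"
      by (intro null[OF A _ outside(1)]) simp_all
    then show "(\<integral>\<^sup>+x. g q x * indicator A x \<partial>M) = (\<integral>\<^sup>+x. 0 * indicator A x \<partial>M)"
      unfolding g[OF A] by simp
  qed simp_all
  have one: "AE x in M. g q x = 1" if "1 \<le> q" for q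
  proof (rule AE_eq_of_set_integrals)
    fix A assume A: "A \<in> sets M"
    have "(1::real) \<le> of_rat q" using that by simp
    then have "emeasure \<rho> (A \<times> {of_rat q<..}) = 0"
      by (intro null[OF A _ outside(2)]) simp_all
    then have "emeasure \<rho> (A \<times> {..of_rat q}) = emeasure \<rho> (A \<times> {..of_rat q} \<union> A \<times> {of_rat q<..})"
      using A by (subst plus_emeasure[symmetric]) (auto intro!: times)
    also have "A \<times> {..of_rat q} \<union> A \<times> {of_rat q<..} = A \<times> (UNIV :: real set)"
      by auto
    finally show "(\<integral>\<^sup>+x. g q x * indicator A x \<partial>M) = (\<integral>\<^sup>+x. 1 * indicator A x \<partial>M)"
      unfolding g[OF A] marg[OF A] using A by simp
  qed simp_all
  define good where "good x \<longleftrightarrow> (\<forall>q r. q \<le> r \<longrightarrow> g q x \<le> g r x) \<and> (\<forall>q<0. g q x = 0) \<and> (\<forall>q\<ge>1. g q x = 1)" for x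
  have good: "AE x in M. good x"
  proof -
    have "AE x in M. \<forall>q r. q \<le> r \<longrightarrow> g q x \<le> g r x"
      unfolding AE_all_countable using mono by auto
    moreover have "AE x in M. \<forall>q<0. g q x = 0"
      unfolding AE_all_countable using zero by auto
    moreover have "AE x in M. \<forall>q\<ge>1. g q x = 1"
      unfolding AE_all_countable using one by auto
    ultimately show ?thesis
      unfolding good_def by eventually_elim blast
  qed
  have [measurable]: "Measurable.pred M good"
    unfolding good_def by measurable
  \<comment> \<open>off the good set the distribution function of the point mass at 0 serves as a default\<close>
  define h where "h x q = (if good x then enn2real (g q x) else if q < 0 then 0 else 1)" for x q
  have [measurable]: "(\<lambda>x. h x q) \<in> borel_measurable M" for q
    unfolding h_def by measurable
  have g_mono: "g q x \<le> g r x" if "good x" "q \<le> r" for x q r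
    using that(1)[unfolded good_def] that(2) by blast
  have g1: "g q x \<le> 1" if "good x" for q x
  proof -
    have "g (max q 1) x = 1"
      using that[unfolded good_def] max.cobounded2[of 1 q] by blast
    then show ?thesis
      using g_mono[OF that, of q "max q 1"] by simp
  qed
  have gh: "g q x = ennreal (h x q)" if "good x" for q x
    using le_less_trans[OF g1[OF that] ennreal_one_less_top] that by (simp add: h_def)
  have h_mono: "h x q \<le> h x r" if "q \<le> r" for x q r
  proof (cases "good x")
    case True
    then have "g q x \<le> g r x" "g r x < top"
      using g_mono[OF True that] le_less_trans[OF g1[OF True] ennreal_one_less_top] by auto
    with True show ?thesis
      by (simp add: h_def enn2real_mono)
  qed (use that in \<open>auto simp: h_def\<close>)
  have h_zero: "h x q = 0" if "q < 0" for x q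
    using that by (auto simp: h_def good_def)
  have h_one: "h x q = 1" if "1 \<le> q" for x q
    using that by (auto simp: h_def good_def)
  have h_bound: "0 \<le> h x q" "h x q \<le> 1" for x q
    using h_mono[of "min q (-1)" q x] h_zero[of "min q (-1)" x] h_mono[of q "max q 1" x] h_one[of "max q 1" x]
    by auto
  define F where "F x t = Inf (h x ` {q. t < of_rat q})" for x and t :: real
  have "mono (h x)" "\<forall>q<0. h x q = 0" "\<forall>q\<ge>1. h x q = 1" for x
    using h_mono h_zero h_one by (auto intro: monoI)
  note env = right_continuous_envelope[OF this, folded F_def]
  define K where "K x = interval_measure (F x)" for x
  have Kp: "prob_space (K x)" for x
    using real_distribution_interval_measure[OF env(1-4)] unfolding K_def real_distribution_def by blast
  have Ks: "sets (K x) = sets borel" for x by (simp add: K_def)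
  have KF: "emeasure (K x) {..t} = ennreal (F x t)" for x t
    unfolding K_def by (rule emeasure_interval_measure_Iic[OF env(1-3)])
  have seq: "\<exists>X. (\<forall>n. t < real_of_rat (X n)) \<and> (\<lambda>n. real_of_rat (X n)) \<longlonglongrightarrow> t" for t :: real
  proof -
    have "\<forall>n. \<exists>q. t < real_of_rat q \<and> real_of_rat q < t + 1 / real (Suc n)"
      using of_rat_dense[of t "t + 1 / real (Suc n)" for n] by simp
    from choice[OF this] obtain X where
      X: "\<And>n. t < real_of_rat (X n)" "\<And>n. real_of_rat (X n) < t + 1 / real (Suc n)"
      by blast
    have "(\<lambda>n. t + 1 / real (Suc n)) \<longlonglongrightarrow> t + 0"
      by (intro tendsto_add tendsto_const lim_1_over_n[THEN LIMSEQ_Suc])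
    then have "(\<lambda>n. t + 1 / real (Suc n)) \<longlonglongrightarrow> t" by simp
    moreover have "\<forall>n. t \<le> real_of_rat (X n)" "\<forall>n. real_of_rat (X n) \<le> t + 1 / real (Suc n)"
      using X by (auto intro: less_imp_le simp del: of_nat_Suc)
    ultimately have "(\<lambda>n. real_of_rat (X n)) \<longlonglongrightarrow> t"
      by (rule tendsto_sandwich[OF always_eventually always_eventually tendsto_const, rotated 2])
    with X(1) show ?thesis by (intro exI[of _ X] conjI allI)
  qed
  have Fm[measurable]: "(\<lambda>x. F x t) \<in> borel_measurable M" for t
  proof -
    obtain X where "\<And>n. t < real_of_rat (X n)" "(\<lambda>n. real_of_rat (X n)) \<longlonglongrightarrow> t"
      using seq[of t] by blast
    then show ?thesis
      by (intro borel_measurable_LIMSEQ_real[OF env(5)[of t X]]) auto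
  qed
  have IicF: "emeasure \<rho> (A \<times> {..t}) = (\<integral>\<^sup>+x\<in>A. emeasure (K x) {..t} \<partial>M)" if A[measurable]: "A \<in> sets M" for A t
  proof -
    obtain X where X: "\<And>n. t < real_of_rat (X n)" "(\<lambda>n. real_of_rat (X n)) \<longlonglongrightarrow> t"
      using seq[of t] by blast
    have gX: "emeasure \<rho> (A \<times> {..of_rat (X n)}) = (\<integral>\<^sup>+x. ennreal (h x (X n)) * indicator A x \<partial>M)" for n
      unfolding g[OF A] using good by (intro nn_integral_cong_AE) (auto simp: gh)
    have "(\<lambda>n. \<integral>\<^sup>+x. ennreal (h x (X n)) * indicator A x \<partial>M) \<longlonglongrightarrow> (\<integral>\<^sup>+x. ennreal (F x t) * indicator A x \<partial>M)"
    proof (rule nn_integral_dominated_convergence[where w="\<lambda>_. 1"])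
      show "AE x in M. (\<lambda>n. ennreal (h x (X n)) * indicator A x) \<longlonglongrightarrow> ennreal (F x t) * indicator A x"
        using env(5)[OF X] by (intro AE_I2) (auto simp: indicator_def intro!: tendsto_ennrealI)
      show "AE x in M. ennreal (h x (X n)) * indicator A x \<le> 1" for n
        using h_bound(2) by (intro AE_I2) (auto simp: indicator_def)
    qed (auto simp: emeasure_space_1)
    moreover have "(\<lambda>n. emeasure \<rho> (A \<times> {..of_rat (X n)})) \<longlonglongrightarrow> emeasure \<rho> (A \<times> {..t})"
    proof -
      have "(\<lambda>n. \<integral>\<^sup>+z. indicator (A \<times> {..of_rat (X n)}) z \<partial>\<rho>) \<longlonglongrightarrow> (\<integral>\<^sup>+z. indicator (A \<times> {..t}) z \<partial>\<rho>)"
      proof (rule nn_integral_dominated_convergence[where w="\<lambda>_. 1"])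
        show "AE z in \<rho>. (\<lambda>n. indicator (A \<times> {..real_of_rat (X n)}) z :: ennreal) \<longlonglongrightarrow> indicator (A \<times> {..t}) z"
        proof (rule AE_I2, rule tendsto_eventually)
          fix z :: "'a \<times> real"
          show "\<forall>\<^sub>F n in sequentially. indicator (A \<times> {..real_of_rat (X n)}) z = (indicator (A \<times> {..t}) z :: ennreal)"
          proof (cases "snd z \<le> t")
            case True
            then have "snd z \<le> real_of_rat (X n)" for n
              using X(1)[of n] by simp
            with True show ?thesis
              by (intro always_eventually) (auto simp: indicator_def mem_Times_iff)
          next
            case False
            then have "\<forall>\<^sub>F n in sequentially. real_of_rat (X n) < snd z"
              by (intro order_tendstoD(2)[OF X(2)]) simp
            then show ?thesis
              by eventually_elim (use False in \<open>auto simp: indicator_def mem_Times_iff\<close>)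
          qed
        qed
      qed (use times A in \<open>auto simp: r.emeasure_space_1 indicator_def\<close>)
      then show ?thesis
        using times A by simp
    qed
    ultimately show ?thesis
      unfolding gX KF by (rule LIMSEQ_unique[rotated])
  qed
  have Km: "K \<in> measurable M (prob_algebra borel)"
  proof (rule measurable_prob_algebraI)
    show "K \<in> measurable M (subprob_algebra borel)"
    proof (rule measurable_subprob_algebra_generated[where \<Omega>=UNIV and G="range (\<lambda>t::real. {..t})"])
      show "sets borel = sigma_sets UNIV (range (\<lambda>t::real. {..t}))"
        by (subst borel_eq_atMost) (rule sets_measure_of, simp)
      show "Int_stable (range (\<lambda>t::real. {..t}))"
        by (auto simp: Int_stable_def)
      show "(\<lambda>a. emeasure (K a) A) \<in> borel_measurable M" if "A \<in> range (\<lambda>t::real. {..t})" for A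
        using that by (auto simp: KF)
      have "emeasure (K a) UNIV = 1" for a
        using prob_space.emeasure_space_1[OF Kp, of a] by (simp add: K_def)
      then show "(\<lambda>a. emeasure (K a) UNIV) \<in> borel_measurable M" by simp
    qed (auto simp: Ks intro: prob_space_imp_subprob_space Kp)
  qed (rule Kp)
  have "emeasure \<rho> (A \<times> B) = (\<integral>\<^sup>+x\<in>A. emeasure (K x) B \<partial>M)" if A[measurable]: "A \<in> sets M" and B: "B \<in> sets borel" for A B
  proof -
    \<comment> \<open>for fixed \<open>A\<close> both sides are finite measures in \<open>B\<close>, equal on half-lines\<close>
    let ?\<rho>A = "distr (density \<rho> (indicator (A \<times> UNIV))) borel snd"
    let ?KA = "bind (density M (indicator A)) K"
    have eA: "emeasure ?\<rho>A B = emeasure \<rho> (A \<times> B)" if B: "B \<in> sets borel" for B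
    proof -
      have sn: "snd \<in> measurable \<rho> borel"
        unfolding measurable_cong_sets[OF \<rho>(1) refl] by (rule measurable_snd)
      have "emeasure ?\<rho>A B = emeasure (density \<rho> (indicator (A \<times> UNIV))) (snd -` B \<inter> space \<rho>)"
        using sn B by (simp add: emeasure_distr)
      also have "\<dots> = (\<integral>\<^sup>+z. indicator (A \<times> UNIV) z * indicator (snd -` B \<inter> space \<rho>) z \<partial>\<rho>)"
        using measurable_sets[OF sn B] times[OF A, of UNIV] by (subst emeasure_density) auto
      also have "\<dots> = (\<integral>\<^sup>+z. indicator (A \<times> B) z \<partial>\<rho>)"
        by (intro nn_integral_cong) (auto simp: indicator_def)
      finally show ?thesis using times[OF A B] by simp
    qed
    have Kd: "K \<in> measurable (density M (indicator A)) (subprob_algebra borel)"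
      using measurable_prob_algebraD[OF Km] by simp
    have eK: "emeasure ?KA B = (\<integral>\<^sup>+x\<in>A. emeasure (K x) B \<partial>M)" if B: "B \<in> sets borel" for B
    proof -
      have [measurable]: "(\<lambda>x. emeasure (K x) B) \<in> borel_measurable M"
        by (rule measurable_compose[OF measurable_prob_algebraD[OF Km] measurable_emeasure_subprob_algebra[OF B]])
      show ?thesis
        using not_empty by (subst emeasure_bind[OF _ Kd B]) (simp_all add: nn_integral_density mult.commute)
    qed
    have "?\<rho>A = ?KA"
    proof (rule measure_eqI_generator_eq[where \<Omega>=UNIV and E="range (\<lambda>t::real. {..t})" and A="\<lambda>n. {..real n}"])
      show "Int_stable (range (\<lambda>t::real. {..t}))"
        by (auto simp: Int_stable_def)
      have s: "sets borel = sigma_sets UNIV (range (\<lambda>t::real. {..t}))"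
        by (subst borel_eq_atMost) (rule sets_measure_of, simp)
      then show "sets ?\<rho>A = sigma_sets UNIV (range (\<lambda>t::real. {..t}))" by simp
      show "sets ?KA = sigma_sets UNIV (range (\<lambda>t::real. {..t}))"
        using s not_empty sets_bind_measurable[OF Kd] by simp
      show "emeasure ?\<rho>A X = emeasure ?KA X" if "X \<in> range (\<lambda>t::real. {..t})" for X
        using that IicF[OF A] by (auto simp: eA eK)
      show "(\<Union>n. {..real n}) = UNIV"
        by (auto intro: real_arch_simple)
      show "emeasure ?\<rho>A {..real n} \<noteq> \<infinity>" for n
        by (simp add: eA)
    qed auto
    then show ?thesis
      using eA[OF B] eK[OF B] by simp
  qed
  with Km show ?thesis
    by (intro bexI[of _ K] ballI)
qed

end

text \<open>
The isomorphism \<open>f\<close> moves the second coordinate to the unit interval, and its inverse \<open>g\<close> mod 0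
moves the conditional measures back. As \<open>g\<close> inverts \<open>f\<close> only almost everywhere, the
null set it misses is absorbed by the second marginal of the polymorphism.
\<close>

lemma lebesgue_space_disintegration:
  assumes L: "lebesgue_space M" and \<nu>: "polymorphism M \<nu>"
  shows "\<exists>K. conditional_system M \<nu> K"
proof -
  interpret prob_space M using L by (simp add: lebesgue_space_def)
  obtain f g where f: "f \<in> measurable M unit_interval" and g: "g \<in> measurable unit_interval M"
    and gf: "AE x in M. g (f x) = x"
    using L unfolding lebesgue_space_def by (elim conjE bexE) (rule that)
  obtain x0 where x0: "x0 \<in> space M" using not_empty by blast
  \<comment> \<open>the kernels live on the whole line, so the inverse map gets an arbitrary value outside the interval\<close>
  define g' where "g' u = (if u \<in> {0..1} then g u else x0)" for u :: real
  have s\<nu>: "sets \<nu> = sets (M \<Otimes>\<^sub>M M)" and m1: "distr \<nu> M fst = M" and m2: "distr \<nu> M snd = M"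
    using \<nu> by (auto simp: polymorphism_def)
  have sp: "space \<nu> = space M \<times> space M"
    using s\<nu> by (metis sets_eq_imp_space_eq space_pair_measure)
  have sn: "snd \<in> measurable \<nu> M"
    unfolding measurable_cong_sets[OF s\<nu> refl] by (rule measurable_snd)
  have f01: "f x \<in> {0..1}" if "x \<in> space M" for x
    using measurable_space[OF f that] by (simp add: unit_interval_def space_restrict_space)
  have fm[measurable]: "f \<in> borel_measurable M"
    using f unfolding unit_interval_def by (simp add: measurable_restrict_space2_iff)
  have g'm[measurable]: "g' \<in> measurable borel M"
    unfolding g'_def
  proof (rule measurable_If_restrict_space_iff[THEN iffD2])
    have "sets unit_interval = sets (restrict_space borel {0..1})"
      unfolding unit_interval_def by (rule sets_restrict_space_cong) simp
    with g have "g \<in> measurable (restrict_space borel {0..1}) M"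
      by (simp cong: measurable_cong_sets)
    then show "g \<in> measurable (restrict_space borel {x. x \<in> {0..1}}) M \<and>
      (\<lambda>u. x0) \<in> measurable (restrict_space borel {x. x \<notin> {0..1}}) M"
      unfolding Collect_mem_eq using x0 by (intro conjI measurable_const)
  qed auto
  have mm: "(\<lambda>z. (fst z, f (snd z))) \<in> measurable \<nu> (M \<Otimes>\<^sub>M borel)"
    unfolding measurable_cong_sets[OF s\<nu> refl] by measurable
  define \<rho> where "\<rho> = distr \<nu> (M \<Otimes>\<^sub>M borel) (\<lambda>z. (fst z, f (snd z)))"
  have "\<exists>K\<in>measurable M (prob_algebra borel). \<forall>A\<in>sets M. \<forall>B\<in>sets borel.
           emeasure \<rho> (A \<times> B) = (\<integral>\<^sup>+x\<in>A. emeasure (K x) B \<partial>M)"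
  proof (rule disintegration_unit_interval)
    show "sets \<rho> = sets (M \<Otimes>\<^sub>M borel)" by (simp add: \<rho>_def)
    have "distr \<rho> M fst = distr \<nu> M fst"
      unfolding \<rho>_def by (subst distr_distr[OF measurable_fst mm]) (simp add: comp_def)
    then show "distr \<rho> M fst = M" by (simp add: m1)
    have "(\<lambda>z. (fst z, f (snd z))) -` (space M \<times> (- {0..1})) \<inter> space \<nu> = {}"
      using f01 by (auto simp: sp)
    then show "emeasure \<rho> (space M \<times> (- {0..1})) = 0"
      unfolding \<rho>_def by (subst emeasure_distr[OF mm]) auto
  qed
  then obtain K where K: "K \<in> measurable M (prob_algebra borel)"
    and eq: "\<And>A B. A \<in> sets M \<Longrightarrow> B \<in> sets borel \<Longrightarrow> emeasure \<rho> (A \<times> B) = (\<integral>\<^sup>+x\<in>A. emeasure (K x) B \<partial>M)"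
    by blast
  have "conditional_system M \<nu> (\<lambda>x. distr (K x) M g')"
    unfolding conditional_system_def
  proof (intro conjI ballI)
    show "(\<lambda>x. distr (K x) M g') \<in> measurable M (prob_algebra M)"
      by (rule measurable_compose[OF K measurable_distr_prob_space[OF g'm]])
    fix A B assume A: "A \<in> sets M" and B: "B \<in> sets M"
    have gB: "g' -` B \<in> sets borel"
      using measurable_sets[OF g'm B] by simp
    have "AE z in distr \<nu> M snd. g' (f z) = z"
      unfolding m2 using gf f01 by (auto simp: g'_def)
    then have AE: "AE z in \<nu>. g' (f (snd z)) = snd z"
      by (rule AE_distrD[OF sn])
    have "emeasure \<nu> (A \<times> B) = emeasure \<nu> ((\<lambda>z. (fst z, f (snd z))) -` (A \<times> g' -` B) \<inter> space \<nu>)"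
    proof (rule emeasure_eq_AE)
      show "AE z in \<nu>. z \<in> A \<times> B \<longleftrightarrow> z \<in> (\<lambda>z. (fst z, f (snd z))) -` (A \<times> g' -` B) \<inter> space \<nu>"
        using AE AE_space by eventually_elim auto
      show "A \<times> B \<in> sets \<nu>" using A B by (simp add: s\<nu>)
      show "(\<lambda>z. (fst z, f (snd z))) -` (A \<times> g' -` B) \<inter> space \<nu> \<in> sets \<nu>"
        using A gB by (intro measurable_sets[OF mm]) simp
    qed
    also have "\<dots> = emeasure \<rho> (A \<times> g' -` B)"
      unfolding \<rho>_def using A gB by (subst emeasure_distr[OF mm]) auto
    also have "\<dots> = (\<integral>\<^sup>+x\<in>A. emeasure (K x) (g' -` B) \<partial>M)"
      by (rule eq[OF A gB])
    also have "\<dots> = (\<integral>\<^sup>+x\<in>A. emeasure (distr (K x) M g') B \<partial>M)"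
    proof (rule nn_integral_cong)
      fix x assume "x \<in> space M"
      then have sK: "sets (K x) = sets borel"
        using measurable_space[OF K] by (auto simp: space_prob_algebra)
      then have "g' \<in> measurable (K x) M" "space (K x) = UNIV"
        by (simp_all cong: measurable_cong_sets add: sets_eq_imp_space_eq[OF sK])
      then show "emeasure (K x) (g' -` B) * indicator A x = emeasure (distr (K x) M g') B * indicator A x"
        using B by (simp add: emeasure_distr)
    qed
    finally show "emeasure \<nu> (A \<times> B) = (\<integral>\<^sup>+x\<in>A. emeasure (distr (K x) M g') B \<partial>M)" .
  qed
  then show ?thesis by blast
qed

section \<open>Polymorphisms and conjugation\<close>

text \<open>
Existence of conditional measures is the only consequence of being a Lebesgue space that
the algebra of polymorphisms rests on.
\<close>

locale disintegrable_space = prob_space +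
  assumes disintegration: "polymorphism M \<nu> \<Longrightarrow> \<exists>K. conditional_system M \<nu> K"

definition preserves_measure :: "'a measure \<Rightarrow> ('a \<Rightarrow> 'a) \<Rightarrow> bool" where
  "preserves_measure M T \<longleftrightarrow> T \<in> measurable M M \<and> distr M M T = M"

lemma polymorphism_sets: "polymorphism M \<nu> \<Longrightarrow> sets \<nu> = sets (M \<Otimes>\<^sub>M M)"
  by (simp add: polymorphism_def)

lemma polymorphism_space: "polymorphism M \<nu> \<Longrightarrow> space \<nu> = space M \<times> space M"
  by (metis polymorphism_sets sets_eq_imp_space_eq space_pair_measure)

lemma polymorphism_measurable:
  assumes "polymorphism M \<nu>"
  shows "fst \<in> measurable \<nu> M" "snd \<in> measurable \<nu> M"
  unfolding measurable_cong_sets[OF polymorphism_sets[OF assms] refl]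
  by (rule measurable_fst measurable_snd)+

lemma nn_integral_polymorphism_snd:
  assumes "polymorphism M \<nu>" "f \<in> borel_measurable M"
  shows "(\<integral>\<^sup>+z. f (snd z) \<partial>\<nu>) = (\<integral>\<^sup>+x. f x \<partial>M)"
  using nn_integral_distr[OF polymorphism_measurable(2)[OF assms(1)], of f] assms
  by (simp add: polymorphism_def)

lemma AE_polymorphism_snd:
  assumes "polymorphism M \<nu>" "AE x in M. Q x"
  shows "AE z in \<nu>. Q (snd z)"
proof -
  have "AE x in distr \<nu> M snd. Q x"
    using assms by (simp only: polymorphism_def)
  then show ?thesis
    by (rule AE_distrD[OF polymorphism_measurable(2)[OF assms(1)]])
qed

lemma emeasure_polymorphism_Times:
  assumes "polymorphism M \<nu>" "A \<in> sets M" "B \<in> sets M"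
  shows "emeasure \<nu> (A \<times> B) = (\<integral>\<^sup>+z. indicator A (fst z) * indicator B (snd z) \<partial>\<nu>)"
proof -
  have "A \<times> B \<in> sets \<nu>"
    using assms by (simp add: polymorphism_sets)
  then have "emeasure \<nu> (A \<times> B) = (\<integral>\<^sup>+z. indicator (A \<times> B) z \<partial>\<nu>)"
    by simp
  also have "\<dots> = (\<integral>\<^sup>+z. indicator A (fst z) * indicator B (snd z) \<partial>\<nu>)"
    by (intro nn_integral_cong) (auto simp: indicator_def)
  finally show ?thesis .
qed

lemma preserves_measure_funpow:
  assumes "preserves_measure M T"
  shows "preserves_measure M (T ^^ n)"
proof (induction n)
  case 0
  then show ?case by (simp add: preserves_measure_def distr_id2)
next
  case (Suc n)
  with assms have "distr (distr M M (T ^^ n)) M T = M" "T ^^ n \<in> measurable M M" "T \<in> measurable M M"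
    by (auto simp: preserves_measure_def)
  then show ?case
    by (simp add: preserves_measure_def distr_distr measurable_comp[unfolded comp_def] comp_def)
qed

lemma conjugate_conjugate:
  assumes "polymorphism M \<nu>"
  shows "conjugate M (conjugate M \<nu>) = \<nu>"
proof -
  have 1: "(\<lambda>(x, y). (y, x)) \<in> measurable \<nu> (M \<Otimes>\<^sub>M M)"
    unfolding measurable_cong_sets[OF polymorphism_sets[OF assms] refl] by measurable
  have "distr \<nu> (M \<Otimes>\<^sub>M M) (\<lambda>z. z) = \<nu>"
    using polymorphism_sets[OF assms] by (simp add: distr_id2)
  moreover have "((\<lambda>(x, y). (y, x)) \<circ> (\<lambda>(x, y). (y, x))) = (\<lambda>z::'a \<times> 'a. z)"
    by (auto simp: fun_eq_iff)
  ultimately show ?thesis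
    unfolding conjugate_def by (subst distr_distr) (auto simp: 1)
qed

lemma nn_integral_conjugate:
  assumes "polymorphism M \<nu>" "f \<in> borel_measurable (M \<Otimes>\<^sub>M M)"
  shows "(\<integral>\<^sup>+z. f z \<partial>conjugate M \<nu>) = (\<integral>\<^sup>+z. f (snd z, fst z) \<partial>\<nu>)"
proof -
  have 1: "(\<lambda>(x, y). (y, x)) \<in> measurable \<nu> (M \<Otimes>\<^sub>M M)"
    unfolding measurable_cong_sets[OF polymorphism_sets[OF assms(1)] refl] by measurable
  show ?thesis
    unfolding conjugate_def
    by (subst nn_integral_distr[OF 1]) (simp_all add: assms(2) case_prod_beta)
qed

lemma polymorphism_conjugate:
  assumes "polymorphism M \<nu>"
  shows "polymorphism M (conjugate M \<nu>)"
proof -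
  have 1: "(\<lambda>(x, y). (y, x)) \<in> measurable \<nu> (M \<Otimes>\<^sub>M M)"
    unfolding measurable_cong_sets[OF polymorphism_sets[OF assms(1)] refl] by measurable
  have 2: "fst \<circ> (\<lambda>(x, y). (y, x)) = (snd :: 'a \<times> 'a \<Rightarrow> 'a)" "snd \<circ> (\<lambda>(x, y). (y, x)) = (fst :: 'a \<times> 'a \<Rightarrow> 'a)"
    by (auto simp: fun_eq_iff)
  have "distr (conjugate M \<nu>) M fst = distr \<nu> M snd" "distr (conjugate M \<nu>) M snd = distr \<nu> M fst"
    unfolding conjugate_def distr_distr[OF measurable_fst 1] distr_distr[OF measurable_snd 1] 2
    by (rule refl)+
  then show ?thesis
    using assms by (simp add: polymorphism_def) (simp add: conjugate_def)
qed

lemma emeasure_conjugate_Times: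
  assumes "polymorphism M \<nu>" "A \<in> sets M" "B \<in> sets M"
  shows "emeasure (conjugate M \<nu>) (A \<times> B) = emeasure \<nu> (B \<times> A)"
proof -
  have [measurable]: "(\<lambda>(x, y). (y, x)) \<in> measurable \<nu> (M \<Otimes>\<^sub>M M)"
    unfolding measurable_cong_sets[OF polymorphism_sets[OF assms(1)] refl] by measurable
  have "(\<lambda>(x, y). (y, x)) -` (A \<times> B) \<inter> space \<nu> = B \<times> A"
    using assms sets.sets_into_space by (fastforce simp: polymorphism_space)
  then show ?thesis
    using assms unfolding conjugate_def by (subst emeasure_distr) auto
qed

context prob_space
begin

lemma prob_space_polymorphism:
  assumes "polymorphism M \<nu>"
  shows "prob_space \<nu>"
proof -
  have "prob_space (distr \<nu> M fst)"
    using assms prob_space_axioms by (simp add: polymorphism_def)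
  then show ?thesis
    using prob_space_distrD polymorphism_measurable(1)[OF assms] by blast
qed

text \<open>
Rectangles are closed under intersection and generate the product sigma-algebra, so
identities between polymorphisms reduce to integrals of \<open>1\<^sub>A(x) 1\<^sub>B(y)\<close>.
\<close>

lemma polymorphism_eqI:
  assumes \<nu>: "polymorphism M \<nu>" and \<nu>': "polymorphism M \<nu>'"
    and eq: "\<And>A B. A \<in> sets M \<Longrightarrow> B \<in> sets M \<Longrightarrow> emeasure \<nu> (A \<times> B) = emeasure \<nu>' (A \<times> B)"
  shows "\<nu> = \<nu>'"
proof (rule measure_eqI_generator_eq[OF Int_stable_pair_measure_generator[of M M]])
  interpret n: prob_space \<nu> by (rule prob_space_polymorphism) fact
  let ?E = "{a \<times> b |a b. a \<in> sets M \<and> b \<in> sets M}"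
  show "?E \<subseteq> Pow (space (M \<Otimes>\<^sub>M M))"
    using sets.space_closed[of M] by (auto simp: space_pair_measure)
  show "sets \<nu> = sigma_sets (space (M \<Otimes>\<^sub>M M)) ?E" "sets \<nu>' = sigma_sets (space (M \<Otimes>\<^sub>M M)) ?E"
    using \<nu> \<nu>' by (simp_all add: polymorphism_def sets_pair_measure space_pair_measure)
  show "range (\<lambda>_::nat. space M \<times> space M) \<subseteq> ?E" by auto
  show "(\<Union>i::nat. space M \<times> space M) = space (M \<Otimes>\<^sub>M M)"
    by (simp add: space_pair_measure)
qed (use eq prob_space.emeasure_space_1[OF prob_space_polymorphism[OF \<nu>]] in
    \<open>auto simp: polymorphism_space[OF \<nu>]\<close>)

lemma kernel_section_measurable:
  assumes "K \<in> measurable M (prob_algebra M)"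
  shows "(\<lambda>x. bind (K x) (\<lambda>y. return (M \<Otimes>\<^sub>M M) (x, y))) \<in> measurable M (subprob_algebra (M \<Otimes>\<^sub>M M))"
proof (rule measurable_bind)
  show "K \<in> measurable M (subprob_algebra M)"
    using assms by (rule measurable_prob_algebraD)
  show "(\<lambda>x. return (M \<Otimes>\<^sub>M M) (fst x, snd x)) \<in> measurable (M \<Otimes>\<^sub>M M) (subprob_algebra (M \<Otimes>\<^sub>M M))"
    by simp
qed

lemma sets_poly_of_kernel:
  assumes "K \<in> measurable M (prob_algebra M)"
  shows "sets (poly_of_kernel M K) = sets (M \<Otimes>\<^sub>M M)"
  unfolding poly_of_kernel_def
  by (rule sets_bind_measurable[OF kernel_section_measurable[OF assms] not_empty])

lemma nn_integral_poly_of_kernel: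
  assumes K: "K \<in> measurable M (prob_algebra M)" and f[measurable]: "f \<in> borel_measurable (M \<Otimes>\<^sub>M M)"
  shows "(\<integral>\<^sup>+z. f z \<partial>poly_of_kernel M K) = (\<integral>\<^sup>+x. \<integral>\<^sup>+y. f (x, y) \<partial>K x \<partial>M)"
  unfolding poly_of_kernel_def
proof (subst nn_integral_bind[OF f kernel_section_measurable[OF K]], intro nn_integral_cong)
  fix x assume x: "x \<in> space M"
  have sK: "sets (K x) = sets M" and spK: "space (K x) = space M"
    using measurable_space[OF K x] by (auto simp: space_prob_algebra dest: sets_eq_imp_space_eq)
  have "(\<lambda>y. return (M \<Otimes>\<^sub>M M) (x, y)) \<in> measurable (K x) (subprob_algebra (M \<Otimes>\<^sub>M M))"
    unfolding measurable_cong_sets[OF sK refl]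
    by (rule measurable_compose[OF measurable_Pair1'[OF x] return_measurable])
  then show "(\<integral>\<^sup>+z. f z \<partial>bind (K x) (\<lambda>y. return (M \<Otimes>\<^sub>M M) (x, y))) = (\<integral>\<^sup>+y. f (x, y) \<partial>K x)"
    by (subst nn_integral_bind[OF f])
       (auto intro!: nn_integral_cong nn_integral_return simp: spK x space_pair_measure)
qed

lemma emeasure_poly_of_kernel_Times:
  assumes K: "K \<in> measurable M (prob_algebra M)" and [measurable]: "A \<in> sets M" "B \<in> sets M"
  shows "emeasure (poly_of_kernel M K) (A \<times> B) = (\<integral>\<^sup>+x\<in>A. emeasure (K x) B \<partial>M)"
proof -
  have "emeasure (poly_of_kernel M K) (A \<times> B) = (\<integral>\<^sup>+z. indicator (A \<times> B) z \<partial>poly_of_kernel M K)"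
    by (simp add: sets_poly_of_kernel[OF K])
  also have "\<dots> = (\<integral>\<^sup>+x. \<integral>\<^sup>+y. indicator (A \<times> B) (x, y) \<partial>K x \<partial>M)"
    by (rule nn_integral_poly_of_kernel[OF K]) simp
  also have "\<dots> = (\<integral>\<^sup>+x\<in>A. emeasure (K x) B \<partial>M)"
  proof (rule nn_integral_cong)
    fix x assume x: "x \<in> space M"
    have "B \<in> sets (K x)"
      using measurable_space[OF K x] by (simp add: space_prob_algebra)
    then show "(\<integral>\<^sup>+y. indicator (A \<times> B) (x, y) \<partial>K x) = emeasure (K x) B * indicator A x"
      by (cases "x \<in> A") (simp_all add: indicator_times)
  qed
  finally show ?thesis .
qed

lemma polymorphism_poly_of_kernel:
  assumes K: "K \<in> measurable M (prob_algebra M)"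
    and inv: "\<And>B. B \<in> sets M \<Longrightarrow> (\<integral>\<^sup>+x. emeasure (K x) B \<partial>M) = emeasure M B"
  shows "polymorphism M (poly_of_kernel M K)"
proof -
  let ?n = "poly_of_kernel M K"
  have s: "sets ?n = sets (M \<Otimes>\<^sub>M M)" by (rule sets_poly_of_kernel[OF K])
  then have sp: "space ?n = space M \<times> space M"
    by (metis sets_eq_imp_space_eq space_pair_measure)
  have m: "fst \<in> measurable ?n M" "snd \<in> measurable ?n M"
    unfolding measurable_cong_sets[OF s refl] by (rule measurable_fst measurable_snd)+
  have K1: "emeasure (K x) (space M) = 1" if "x \<in> space M" for x
  proof -
    have "sets (K x) = sets M" "prob_space (K x)"
      using measurable_space[OF K that] by (auto simp: space_prob_algebra)
    then show ?thesis
      by (metis prob_space.emeasure_space_1 sets_eq_imp_space_eq)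
  qed
  have "distr ?n M fst = M"
  proof (rule measure_eqI)
    fix A assume A: "A \<in> sets (distr ?n M fst)"
    then have "fst -` A \<inter> space ?n = A \<times> space M"
      using sets.sets_into_space by (fastforce simp: sp)
    then have "emeasure (distr ?n M fst) A = (\<integral>\<^sup>+x\<in>A. emeasure (K x) (space M) \<partial>M)"
      using A m by (simp add: emeasure_distr emeasure_poly_of_kernel_Times[OF K])
    also have "\<dots> = (\<integral>\<^sup>+x\<in>A. 1 \<partial>M)"
      by (intro nn_integral_cong) (simp add: K1)
    finally show "emeasure (distr ?n M fst) A = emeasure M A"
      using A by simp
  qed simp
  moreover have "distr ?n M snd = M"
  proof (rule measure_eqI)
    fix B assume B: "B \<in> sets (distr ?n M snd)"
    then have "snd -` B \<inter> space ?n = space M \<times> B"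
      using sets.sets_into_space by (fastforce simp: sp)
    then have "emeasure (distr ?n M snd) B = (\<integral>\<^sup>+x\<in>space M. emeasure (K x) B \<partial>M)"
      using B m by (simp add: emeasure_distr emeasure_poly_of_kernel_Times[OF K])
    also have "\<dots> = (\<integral>\<^sup>+x. emeasure (K x) B \<partial>M)"
      by (intro nn_integral_cong) simp
    finally show "emeasure (distr ?n M snd) B = emeasure M B"
      using B inv by simp
  qed simp
  ultimately show ?thesis
    using s by (simp add: polymorphism_def)
qed

text \<open>
The rectangle formula defining a conditional system extends to all measurable sets of the
square, hence conditional measures compute arbitrary nonnegative integrals.
\<close>

lemma conditional_system_imp_eq_poly_of_kernel:
  assumes \<nu>: "polymorphism M \<nu>" and K: "conditional_system M \<nu> K"
  shows "\<nu> = poly_of_kernel M K"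
proof -
  have Km: "K \<in> measurable M (prob_algebra M)"
    and eq: "\<And>A B. A \<in> sets M \<Longrightarrow> B \<in> sets M \<Longrightarrow> emeasure \<nu> (A \<times> B) = (\<integral>\<^sup>+x\<in>A. emeasure (K x) B \<partial>M)"
    using K by (auto simp: conditional_system_def)
  have "polymorphism M (poly_of_kernel M K)"
  proof (rule polymorphism_poly_of_kernel[OF Km])
    fix B assume B: "B \<in> sets M"
    have "emeasure M B = emeasure (distr \<nu> M snd) B"
      using \<nu> by (simp add: polymorphism_def)
    also have "\<dots> = emeasure \<nu> (space M \<times> B)"
      using B sets.sets_into_space[OF B] polymorphism_measurable[OF \<nu>]
      by (auto simp: emeasure_distr polymorphism_space[OF \<nu>] intro!: arg_cong[where f="emeasure \<nu>"])
    also have "\<dots> = (\<integral>\<^sup>+x\<in>space M. emeasure (K x) B \<partial>M)"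
      using eq B by simp
    also have "\<dots> = (\<integral>\<^sup>+x. emeasure (K x) B \<partial>M)"
      by (intro nn_integral_cong) simp
    finally show "(\<integral>\<^sup>+x. emeasure (K x) B \<partial>M) = emeasure M B" ..
  qed
  then show ?thesis
    by (intro polymorphism_eqI[OF \<nu>]) (simp_all add: eq emeasure_poly_of_kernel_Times[OF Km])
qed

lemma nn_integral_conditional_system:
  assumes \<nu>: "polymorphism M \<nu>" and K: "conditional_system M \<nu> K"
    and f[measurable]: "f \<in> borel_measurable M" and g[measurable]: "g \<in> borel_measurable M"
  shows "(\<integral>\<^sup>+z. f (fst z) * g (snd z) \<partial>\<nu>) = (\<integral>\<^sup>+x. f x * (\<integral>\<^sup>+y. g y \<partial>K x) \<partial>M)"
proof -
  have Km: "K \<in> measurable M (prob_algebra M)"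
    using K by (auto simp: conditional_system_def)
  have "(\<integral>\<^sup>+z. f (fst z) * g (snd z) \<partial>\<nu>) = (\<integral>\<^sup>+x. \<integral>\<^sup>+y. f x * g y \<partial>K x \<partial>M)"
    by (subst conditional_system_imp_eq_poly_of_kernel[OF \<nu> K], subst nn_integral_poly_of_kernel[OF Km]) simp_all
  also have "\<dots> = (\<integral>\<^sup>+x. f x * (\<integral>\<^sup>+y. g y \<partial>K x) \<partial>M)"
  proof (rule nn_integral_cong)
    fix x assume "x \<in> space M"
    then have "sets (K x) = sets M"
      using measurable_space[OF Km] by (auto simp: space_prob_algebra)
    then have "g \<in> borel_measurable (K x)"
      by (simp cong: measurable_cong_sets)
    then show "(\<integral>\<^sup>+y. f x * g y \<partial>K x) = f x * (\<integral>\<^sup>+y. g y \<partial>K x)"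
      by (rule nn_integral_cmult)
  qed
  finally show ?thesis .
qed

end

section \<open>The product and its Markov operator\<close>

text \<open>
The Markov operator of a polymorphism, on nonnegative extended functions so that no
integrability has to be tracked.
\<close>

definition markov :: "'a measure \<Rightarrow> ('a \<times> 'a) measure \<Rightarrow> ('a \<Rightarrow> ennreal) \<Rightarrow> 'a \<Rightarrow> ennreal" where
  "markov M \<nu> g x = (\<integral>\<^sup>+y. g y \<partial>cond_measure M \<nu> x)"

context disintegrable_space
begin

lemma conditional_system_cond_measure:
  "polymorphism M \<nu> \<Longrightarrow> conditional_system M \<nu> (cond_measure M \<nu>)"
  unfolding cond_measure_def by (rule someI_ex[OF disintegration])

lemma cond_measure_measurable:
  "polymorphism M \<nu> \<Longrightarrow> cond_measure M \<nu> \<in> measurable M (prob_algebra M)"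
  using conditional_system_cond_measure by (simp add: conditional_system_def)

lemma markov_measurable:
  assumes "polymorphism M \<nu>" "g \<in> borel_measurable M"
  shows "markov M \<nu> g \<in> borel_measurable M"
  unfolding markov_def
  by (rule measurable_compose[OF measurable_prob_algebraD[OF cond_measure_measurable]
        nn_integral_measurable_subprob_algebra]) fact+

lemma nn_integral_markov:
  assumes "polymorphism M \<nu>" "f \<in> borel_measurable M" "g \<in> borel_measurable M"
  shows "(\<integral>\<^sup>+z. f (fst z) * g (snd z) \<partial>\<nu>) = (\<integral>\<^sup>+x. f x * markov M \<nu> g x \<partial>M)"
  unfolding markov_def
  by (rule nn_integral_conditional_system[OF assms(1) conditional_system_cond_measure assms(2,3)]) fact

text \<open>
Conditional measures are chosen arbitrarily within their class mod 0. This lemma replaces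
the choice by any convenient representative: integrals over rectangles determine the
Markov operator almost everywhere.
\<close>

lemma markov_AE_eqI:
  assumes \<nu>: "polymorphism M \<nu>" and [measurable]: "g \<in> borel_measurable M" "h \<in> borel_measurable M"
    and eq: "\<And>A. A \<in> sets M \<Longrightarrow>
      (\<integral>\<^sup>+z. indicator A (fst z) * g (snd z) \<partial>\<nu>) = (\<integral>\<^sup>+x. indicator A x * h x \<partial>M)"
  shows "AE x in M. markov M \<nu> g x = h x"
proof -
  have [measurable]: "markov M \<nu> g \<in> borel_measurable M"
    by (rule markov_measurable[OF \<nu>]) simp
  have "density M (markov M \<nu> g) = density M h"
  proof (rule measure_eqI)
    fix A assume "A \<in> sets (density M (markov M \<nu> g))"
    then have [measurable]: "A \<in> sets M" by simp
    show "emeasure (density M (markov M \<nu> g)) A = emeasure (density M h) A"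
      using eq[of A] nn_integral_markov[OF \<nu>, of "indicator A" g]
      by (simp add: emeasure_density mult.commute)
  qed simp
  then show ?thesis
    by (intro density_unique) simp_all
qed

lemma nn_integral_poly_prod_markov:
  assumes \<nu>1: "polymorphism M \<nu>\<^sub>1" and \<nu>2: "polymorphism M \<nu>\<^sub>2"
    and f[measurable]: "f \<in> borel_measurable M" and g[measurable]: "g \<in> borel_measurable M"
  shows "(\<integral>\<^sup>+z. f (fst z) * g (snd z) \<partial>poly_prod M \<nu>\<^sub>1 \<nu>\<^sub>2) = (\<integral>\<^sup>+x. f x * markov M \<nu>\<^sub>2 (markov M \<nu>\<^sub>1 g) x \<partial>M)"
proof -
  let ?K1 = "cond_measure M \<nu>\<^sub>1" and ?K2 = "cond_measure M \<nu>\<^sub>2"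
  let ?K = "\<lambda>x. bind (?K2 x) ?K1"
  have K1: "?K1 \<in> measurable M (prob_algebra M)" and K2: "?K2 \<in> measurable M (prob_algebra M)"
    using \<nu>1 \<nu>2 by (auto intro: cond_measure_measurable)
  have K: "?K \<in> measurable M (prob_algebra M)"
    using K2 K1 by (rule measurable_bind_prob_space)
  have "(\<integral>\<^sup>+z. f (fst z) * g (snd z) \<partial>poly_prod M \<nu>\<^sub>1 \<nu>\<^sub>2) = (\<integral>\<^sup>+x. \<integral>\<^sup>+y. f x * g y \<partial>?K x \<partial>M)"
    unfolding poly_prod_def by (subst nn_integral_poly_of_kernel[OF K]) simp_all
  also have "\<dots> = (\<integral>\<^sup>+x. f x * markov M \<nu>\<^sub>2 (markov M \<nu>\<^sub>1 g) x \<partial>M)"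
  proof (rule nn_integral_cong)
    fix x assume x: "x \<in> space M"
    then have "sets (?K x) = sets M" and s2: "sets (?K2 x) = sets M"
      using measurable_space[OF K x] measurable_space[OF K2 x] by (auto simp: space_prob_algebra)
    then have "g \<in> borel_measurable (?K x)"
      by (simp cong: measurable_cong_sets)
    then have "(\<integral>\<^sup>+y. f x * g y \<partial>?K x) = f x * (\<integral>\<^sup>+y. g y \<partial>?K x)"
      by (rule nn_integral_cmult)
    also have "(\<integral>\<^sup>+y. g y \<partial>?K x) = (\<integral>\<^sup>+y. \<integral>\<^sup>+w. g w \<partial>?K1 y \<partial>?K2 x)"
      using measurable_prob_algebraD[OF K1]
      by (intro nn_integral_bind[OF g]) (simp cong: measurable_cong_sets add: s2)
    finally show "(\<integral>\<^sup>+y. f x * g y \<partial>?K x) = f x * markov M \<nu>\<^sub>2 (markov M \<nu>\<^sub>1 g) x"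
      by (simp add: markov_def)
  qed
  finally show ?thesis .
qed

text \<open>
The product is integrated by applying the Markov operator of the left factor and
integrating against the right one; in particular only values almost everywhere of that
operator matter, since the second marginal of \<open>\<nu>\<^sub>2\<close> is \<open>M\<close>.
\<close>

lemma nn_integral_poly_prod:
  assumes \<nu>1: "polymorphism M \<nu>\<^sub>1" and \<nu>2: "polymorphism M \<nu>\<^sub>2"
    and f: "f \<in> borel_measurable M" and g: "g \<in> borel_measurable M"
  shows "(\<integral>\<^sup>+z. f (fst z) * g (snd z) \<partial>poly_prod M \<nu>\<^sub>1 \<nu>\<^sub>2) = (\<integral>\<^sup>+z. f (fst z) * markov M \<nu>\<^sub>1 g (snd z) \<partial>\<nu>\<^sub>2)"
  using nn_integral_poly_prod_markov[OF assms] nn_integral_markov[OF \<nu>2 f markov_measurable[OF \<nu>1 g]]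
  by simp

lemma polymorphism_poly_prod:
  assumes \<nu>1: "polymorphism M \<nu>\<^sub>1" and \<nu>2: "polymorphism M \<nu>\<^sub>2"
  shows "polymorphism M (poly_prod M \<nu>\<^sub>1 \<nu>\<^sub>2)"
proof -
  let ?K1 = "cond_measure M \<nu>\<^sub>1" and ?K2 = "cond_measure M \<nu>\<^sub>2"
  let ?K = "\<lambda>x. bind (?K2 x) ?K1"
  have K1: "?K1 \<in> measurable M (prob_algebra M)" and K2: "?K2 \<in> measurable M (prob_algebra M)"
    using \<nu>1 \<nu>2 by (auto intro: cond_measure_measurable)
  have K: "?K \<in> measurable M (prob_algebra M)"
    using K2 K1 by (rule measurable_bind_prob_space)
  show ?thesis
    unfolding poly_prod_def
  proof (rule polymorphism_poly_of_kernel[OF K])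
    fix B assume B[measurable]: "B \<in> sets M"
    let ?h = "markov M \<nu>\<^sub>1 (indicator B)"
    have [measurable]: "?h \<in> borel_measurable M"
      using \<nu>1 by (rule markov_measurable) simp
    have "(\<integral>\<^sup>+x. emeasure (?K x) B \<partial>M) = (\<integral>\<^sup>+x. emeasure (?K x) B * indicator (space M) x \<partial>M)"
      by (intro nn_integral_cong) simp
    also have "\<dots> = emeasure (poly_of_kernel M ?K) (space M \<times> B)"
      by (simp add: emeasure_poly_of_kernel_Times[OF K])
    also have "\<dots> = (\<integral>\<^sup>+z. indicator (space M \<times> B) z \<partial>poly_of_kernel M ?K)"
      by (simp add: sets_poly_of_kernel[OF K])
    also have "\<dots> = (\<integral>\<^sup>+z. 1 * indicator B (snd z) \<partial>poly_prod M \<nu>\<^sub>1 \<nu>\<^sub>2)"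
      unfolding poly_prod_def
      by (intro nn_integral_cong)
         (auto simp: indicator_def space_pair_measure
               dest: sets_eq_imp_space_eq[OF sets_poly_of_kernel[OF K], THEN equalityD1, THEN subsetD])
    also have "\<dots> = (\<integral>\<^sup>+z. 1 * ?h (snd z) \<partial>\<nu>\<^sub>2)"
      using nn_integral_poly_prod[OF \<nu>1 \<nu>2, of "\<lambda>_. 1" "indicator B"] by simp
    also have "\<dots> = (\<integral>\<^sup>+x. ?h x \<partial>M)"
      using nn_integral_polymorphism_snd[OF \<nu>2, of ?h] by simp
    also have "\<dots> = (\<integral>\<^sup>+z. 1 * indicator B (snd z) \<partial>\<nu>\<^sub>1)"
      using nn_integral_markov[OF \<nu>1, of "\<lambda>_. 1" "indicator B"] by simp
    also have "\<dots> = emeasure M B"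
      using nn_integral_polymorphism_snd[OF \<nu>1, of "indicator B"] by simp
    finally show "(\<integral>\<^sup>+x. emeasure (?K x) B \<partial>M) = emeasure M B" .
  qed
qed

lemma emeasure_poly_prod_Times:
  assumes \<nu>1: "polymorphism M \<nu>\<^sub>1" and \<nu>2: "polymorphism M \<nu>\<^sub>2"
    and A[measurable]: "A \<in> sets M" and B[measurable]: "B \<in> sets M"
    and h: "AE x in M. markov M \<nu>\<^sub>1 (indicator B) x = h x"
  shows "emeasure (poly_prod M \<nu>\<^sub>1 \<nu>\<^sub>2) (A \<times> B) = (\<integral>\<^sup>+z. indicator A (fst z) * h (snd z) \<partial>\<nu>\<^sub>2)"
proof -
  have "emeasure (poly_prod M \<nu>\<^sub>1 \<nu>\<^sub>2) (A \<times> B)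
      = (\<integral>\<^sup>+z. indicator A (fst z) * markov M \<nu>\<^sub>1 (indicator B) (snd z) \<partial>\<nu>\<^sub>2)"
    by (simp add: emeasure_polymorphism_Times[OF polymorphism_poly_prod[OF \<nu>1 \<nu>2]]
        nn_integral_poly_prod[OF \<nu>1 \<nu>2])
  also have "\<dots> = (\<integral>\<^sup>+z. indicator A (fst z) * h (snd z) \<partial>\<nu>\<^sub>2)"
    using AE_polymorphism_snd[OF \<nu>2 h] by (intro nn_integral_cong_AE) auto
  finally show ?thesis .
qed

lemma markov_poly_prod:
  assumes \<nu>1: "polymorphism M \<nu>\<^sub>1" and \<nu>2: "polymorphism M \<nu>\<^sub>2"
    and g: "g \<in> borel_measurable M"
  shows "AE x in M. markov M (poly_prod M \<nu>\<^sub>1 \<nu>\<^sub>2) g x = markov M \<nu>\<^sub>2 (markov M \<nu>\<^sub>1 g) x"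
  by (rule markov_AE_eqI[OF polymorphism_poly_prod[OF \<nu>1 \<nu>2] g
        markov_measurable[OF \<nu>2 markov_measurable[OF \<nu>1 g]]])
     (rule nn_integral_poly_prod_markov[OF \<nu>1 \<nu>2 _ g], simp)

text \<open>
The Markov operator of a product is the composition of the Markov operators in reverse
order, so associativity is inherited from composition.
\<close>

lemma poly_prod_assoc:
  assumes \<nu>1: "polymorphism M \<nu>\<^sub>1" and \<nu>2: "polymorphism M \<nu>\<^sub>2" and \<nu>3: "polymorphism M \<nu>\<^sub>3"
  shows "poly_prod M (poly_prod M \<nu>\<^sub>1 \<nu>\<^sub>2) \<nu>\<^sub>3 = poly_prod M \<nu>\<^sub>1 (poly_prod M \<nu>\<^sub>2 \<nu>\<^sub>3)"
proof (rule polymorphism_eqI)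
  show "polymorphism M (poly_prod M (poly_prod M \<nu>\<^sub>1 \<nu>\<^sub>2) \<nu>\<^sub>3)"
    "polymorphism M (poly_prod M \<nu>\<^sub>1 (poly_prod M \<nu>\<^sub>2 \<nu>\<^sub>3))"
    using assms by (auto intro: polymorphism_poly_prod)
  fix A B assume A[measurable]: "A \<in> sets M" and B[measurable]: "B \<in> sets M"
  have "emeasure (poly_prod M \<nu>\<^sub>1 (poly_prod M \<nu>\<^sub>2 \<nu>\<^sub>3)) (A \<times> B)
      = (\<integral>\<^sup>+z. indicator A (fst z) * markov M \<nu>\<^sub>1 (indicator B) (snd z) \<partial>poly_prod M \<nu>\<^sub>2 \<nu>\<^sub>3)"
    by (rule emeasure_poly_prod_Times[OF \<nu>1 polymorphism_poly_prod[OF \<nu>2 \<nu>3] A B]) simp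
  also have "\<dots> = (\<integral>\<^sup>+z. indicator A (fst z) * markov M \<nu>\<^sub>2 (markov M \<nu>\<^sub>1 (indicator B)) (snd z) \<partial>\<nu>\<^sub>3)"
    by (rule nn_integral_poly_prod[OF \<nu>2 \<nu>3]) (auto intro: markov_measurable[OF \<nu>1])
  also have "\<dots> = emeasure (poly_prod M (poly_prod M \<nu>\<^sub>1 \<nu>\<^sub>2) \<nu>\<^sub>3) (A \<times> B)"
    by (rule emeasure_poly_prod_Times[OF polymorphism_poly_prod[OF \<nu>1 \<nu>2] \<nu>3 A B, symmetric])
       (rule markov_poly_prod[OF \<nu>1 \<nu>2], simp)
  finally show "emeasure (poly_prod M (poly_prod M \<nu>\<^sub>1 \<nu>\<^sub>2) \<nu>\<^sub>3) (A \<times> B)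
    = emeasure (poly_prod M \<nu>\<^sub>1 (poly_prod M \<nu>\<^sub>2 \<nu>\<^sub>3)) (A \<times> B)" ..
qed

text \<open>
Conjugation is passage to the adjoint Markov operator and therefore reverses products.
The proof moves the two operators across the pairing one at a time; every statement on
left factors thereby yields its mirror image on right factors.
\<close>

lemma conjugate_poly_prod:
  assumes \<nu>1: "polymorphism M \<nu>\<^sub>1" and \<nu>2: "polymorphism M \<nu>\<^sub>2"
  shows "conjugate M (poly_prod M \<nu>\<^sub>1 \<nu>\<^sub>2) = poly_prod M (conjugate M \<nu>\<^sub>2) (conjugate M \<nu>\<^sub>1)"
proof (rule polymorphism_eqI)
  show "polymorphism M (conjugate M (poly_prod M \<nu>\<^sub>1 \<nu>\<^sub>2))"
    "polymorphism M (poly_prod M (conjugate M \<nu>\<^sub>2) (conjugate M \<nu>\<^sub>1))"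
    using assms by (auto intro: polymorphism_poly_prod polymorphism_conjugate)
  fix A B assume A[measurable]: "A \<in> sets M" and B[measurable]: "B \<in> sets M"
  note c1 = polymorphism_conjugate[OF \<nu>1] and c2 = polymorphism_conjugate[OF \<nu>2]
  let ?g = "markov M (conjugate M \<nu>\<^sub>2) (indicator B)" and ?h = "markov M \<nu>\<^sub>1 (indicator A)"
  have [measurable]: "?g \<in> borel_measurable M" "?h \<in> borel_measurable M"
    by (auto intro: markov_measurable c2 \<nu>1)
  have "emeasure (poly_prod M (conjugate M \<nu>\<^sub>2) (conjugate M \<nu>\<^sub>1)) (A \<times> B)
      = (\<integral>\<^sup>+z. indicator A (fst z) * ?g (snd z) \<partial>conjugate M \<nu>\<^sub>1)"
    by (rule emeasure_poly_prod_Times[OF c2 c1 A B]) simp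
  also have "\<dots> = (\<integral>\<^sup>+z. ?g (fst z) * indicator A (snd z) \<partial>\<nu>\<^sub>1)"
    by (subst nn_integral_conjugate[OF \<nu>1]) (simp_all add: mult.commute)
  also have "\<dots> = (\<integral>\<^sup>+x. ?h x * ?g x \<partial>M)"
    by (subst nn_integral_markov[OF \<nu>1]) (simp_all add: mult.commute)
  also have "\<dots> = (\<integral>\<^sup>+z. ?h (fst z) * indicator B (snd z) \<partial>conjugate M \<nu>\<^sub>2)"
    by (subst nn_integral_markov[OF c2]) simp_all
  also have "\<dots> = (\<integral>\<^sup>+z. indicator B (fst z) * ?h (snd z) \<partial>\<nu>\<^sub>2)"
    by (subst nn_integral_conjugate[OF \<nu>2]) (simp_all add: mult.commute)
  also have "\<dots> = emeasure (poly_prod M \<nu>\<^sub>1 \<nu>\<^sub>2) (B \<times> A)"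
    by (rule emeasure_poly_prod_Times[OF \<nu>1 \<nu>2 B A, symmetric]) simp
  also have "\<dots> = emeasure (conjugate M (poly_prod M \<nu>\<^sub>1 \<nu>\<^sub>2)) (A \<times> B)"
    by (rule emeasure_conjugate_Times[OF polymorphism_poly_prod[OF \<nu>1 \<nu>2] A B, symmetric])
  finally show "emeasure (conjugate M (poly_prod M \<nu>\<^sub>1 \<nu>\<^sub>2)) (A \<times> B)
    = emeasure (poly_prod M (conjugate M \<nu>\<^sub>2) (conjugate M \<nu>\<^sub>1)) (A \<times> B)" ..
qed

end

section \<open>Measure-preserving maps as polymorphisms\<close>

context prob_space
begin

lemma return_kernel_measurable:
  assumes "T \<in> measurable M M"
  shows "(\<lambda>x. return M (T x)) \<in> measurable M (prob_algebra M)"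
  using measurable_compose[OF assms measurable_return_prob_space] .

lemma polymorphism_poly_of_map:
  assumes "preserves_measure M T"
  shows "polymorphism M (poly_of_map M T)"
  unfolding poly_of_map_def
proof (rule polymorphism_poly_of_kernel)
  have T[measurable]: "T \<in> measurable M M" and d: "distr M M T = M"
    using assms by (auto simp: preserves_measure_def)
  show "(\<lambda>x. return M (T x)) \<in> measurable M (prob_algebra M)"
    by (rule return_kernel_measurable) fact
  fix B assume B[measurable]: "B \<in> sets M"
  have "(\<integral>\<^sup>+x. emeasure (return M (T x)) B \<partial>M) = (\<integral>\<^sup>+x. indicator B x \<partial>distr M M T)"
    by (subst nn_integral_distr) auto
  then show "(\<integral>\<^sup>+x. emeasure (return M (T x)) B \<partial>M) = emeasure M B"
    by (simp add: d)
qed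

lemma nn_integral_poly_of_map:
  assumes "preserves_measure M T" and [measurable]: "f \<in> borel_measurable M" "g \<in> borel_measurable M"
  shows "(\<integral>\<^sup>+z. f (fst z) * g (snd z) \<partial>poly_of_map M T) = (\<integral>\<^sup>+x. f x * g (T x) \<partial>M)"
proof -
  have T: "T \<in> measurable M M"
    using assms by (simp add: preserves_measure_def)
  show ?thesis
    unfolding poly_of_map_def
    by (subst nn_integral_poly_of_kernel[OF return_kernel_measurable[OF T]])
       (auto intro!: nn_integral_cong simp: nn_integral_return measurable_space[OF T] nn_integral_cmult)
qed

end

context disintegrable_space
begin

lemma markov_poly_of_map:
  assumes T: "preserves_measure M T" and [measurable]: "g \<in> borel_measurable M"
  shows "AE x in M. markov M (poly_of_map M T) g x = g (T x)"
proof -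
  have [measurable]: "T \<in> measurable M M"
    using T by (simp add: preserves_measure_def)
  show ?thesis
    by (rule markov_AE_eqI[OF polymorphism_poly_of_map[OF T]])
       (simp_all add: nn_integral_poly_of_map[OF T])
qed

lemma emeasure_poly_of_map_Times:
  assumes "preserves_measure M T" "A \<in> sets M" "B \<in> sets M"
  shows "emeasure (poly_of_map M T) (A \<times> B) = (\<integral>\<^sup>+x. indicator A x * indicator B (T x) \<partial>M)"
  using assms
  by (simp add: emeasure_polymorphism_Times[OF polymorphism_poly_of_map] nn_integral_poly_of_map)

text \<open>
Equality almost everywhere is enough, so maps inverse to each other mod 0 give inverse
polymorphisms.
\<close>

lemma poly_prod_poly_of_map:
  assumes T: "preserves_measure M T" and S: "preserves_measure M S"
    and U: "preserves_measure M U" and eq: "AE x in M. T (S x) = U x"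
  shows "poly_prod M (poly_of_map M T) (poly_of_map M S) = poly_of_map M U"
proof (rule polymorphism_eqI)
  note pT = polymorphism_poly_of_map[OF T] and pS = polymorphism_poly_of_map[OF S]
  show "polymorphism M (poly_prod M (poly_of_map M T) (poly_of_map M S))"
    by (rule polymorphism_poly_prod[OF pT pS])
  show "polymorphism M (poly_of_map M U)"
    by (rule polymorphism_poly_of_map[OF U])
  fix A B assume A[measurable]: "A \<in> sets M" and B[measurable]: "B \<in> sets M"
  have [measurable]: "T \<in> measurable M M"
    using T by (simp add: preserves_measure_def)
  have "emeasure (poly_prod M (poly_of_map M T) (poly_of_map M S)) (A \<times> B)
      = (\<integral>\<^sup>+z. indicator A (fst z) * indicator B (T (snd z)) \<partial>poly_of_map M S)"
    by (rule emeasure_poly_prod_Times[OF pT pS A B]) (rule markov_poly_of_map[OF T], simp)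
  also have "\<dots> = (\<integral>\<^sup>+x. indicator A x * indicator B (T (S x)) \<partial>M)"
    by (subst nn_integral_poly_of_map[OF S, of "indicator A" "\<lambda>x. indicator B (T x)"]) simp_all
  also have "\<dots> = (\<integral>\<^sup>+x. indicator A x * indicator B (U x) \<partial>M)"
    using eq by (intro nn_integral_cong_AE) auto
  finally show "emeasure (poly_prod M (poly_of_map M T) (poly_of_map M S)) (A \<times> B)
      = emeasure (poly_of_map M U) (A \<times> B)"
    by (simp add: emeasure_poly_of_map_Times[OF U])
qed

lemma preserves_measure_id: "preserves_measure M (\<lambda>x. x)"
  by (simp add: preserves_measure_def distr_id2)

lemma poly_prod_id_left:
  assumes \<nu>: "polymorphism M \<nu>"
  shows "poly_prod M (poly_of_map M (\<lambda>x. x)) \<nu> = \<nu>"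
proof (rule polymorphism_eqI)
  note pI = polymorphism_poly_of_map[OF preserves_measure_id]
  show "polymorphism M (poly_prod M (poly_of_map M (\<lambda>x. x)) \<nu>)"
    by (rule polymorphism_poly_prod[OF pI \<nu>])
  show "polymorphism M \<nu>" by fact
  fix A B assume AB: "A \<in> sets M" "B \<in> sets M"
  show "emeasure (poly_prod M (poly_of_map M (\<lambda>x. x)) \<nu>) (A \<times> B) = emeasure \<nu> (A \<times> B)"
    using emeasure_poly_prod_Times[OF pI \<nu> AB markov_poly_of_map[OF preserves_measure_id]] AB
    by (simp add: emeasure_polymorphism_Times[OF \<nu>])
qed

lemma conjugate_id: "conjugate M (poly_of_map M (\<lambda>x. x)) = poly_of_map M (\<lambda>x. x)"
proof (rule polymorphism_eqI)
  note pI = polymorphism_poly_of_map[OF preserves_measure_id]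
  show "polymorphism M (conjugate M (poly_of_map M (\<lambda>x. x)))" "polymorphism M (poly_of_map M (\<lambda>x. x))"
    by (auto intro: polymorphism_conjugate pI)
  fix A B assume "A \<in> sets M" "B \<in> sets M"
  then show "emeasure (conjugate M (poly_of_map M (\<lambda>x. x))) (A \<times> B) = emeasure (poly_of_map M (\<lambda>x. x)) (A \<times> B)"
    by (simp add: emeasure_conjugate_Times[OF pI] emeasure_poly_of_map_Times[OF preserves_measure_id] mult.commute)
qed

lemma poly_prod_id_right:
  assumes \<nu>: "polymorphism M \<nu>"
  shows "poly_prod M \<nu> (poly_of_map M (\<lambda>x. x)) = \<nu>"
proof -
  note pI = polymorphism_poly_of_map[OF preserves_measure_id]
  have "conjugate M (poly_prod M \<nu> (poly_of_map M (\<lambda>x. x))) = conjugate M \<nu>"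
    using \<nu> pI by (simp add: conjugate_poly_prod conjugate_id poly_prod_id_left polymorphism_conjugate)
  then show ?thesis
    by (metis conjugate_conjugate \<nu> pI polymorphism_poly_prod)
qed

end

section \<open>Weak limits\<close>

lemma weak_limitD:
  "weak_limit M \<nu>s \<nu> \<Longrightarrow> A \<in> sets M \<Longrightarrow> B \<in> sets M \<Longrightarrow>
    (\<lambda>n. measure (\<nu>s n) (A \<times> B)) \<longlonglongrightarrow> measure \<nu> (A \<times> B)"
  by (simp add: weak_limit_def)

lemma weak_limit_polymorphism: "weak_limit M \<nu>s \<nu> \<Longrightarrow> polymorphism M \<nu>"
  by (simp add: weak_limit_def)

lemma weak_limit_Suc: "weak_limit M \<nu>s \<nu> \<Longrightarrow> weak_limit M (\<lambda>n. \<nu>s (Suc n)) \<nu>"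
  unfolding weak_limit_def using LIMSEQ_Suc by blast

lemma weak_limit_conjugate:
  assumes "\<And>n. polymorphism M (\<nu>s n)" "weak_limit M \<nu>s \<nu>"
  shows "weak_limit M (\<lambda>n. conjugate M (\<nu>s n)) (conjugate M \<nu>)"
  using assms unfolding weak_limit_def
  by (auto simp: measure_def emeasure_conjugate_Times polymorphism_conjugate)

context prob_space
begin

lemma weak_limit_unique:
  assumes 1: "weak_limit M \<nu>s \<nu>" and 2: "weak_limit M \<nu>s \<nu>'"
  shows "\<nu> = \<nu>'"
proof (rule polymorphism_eqI)
  show p: "polymorphism M \<nu>" "polymorphism M \<nu>'"
    using 1 2 by (auto intro: weak_limit_polymorphism)
  interpret n: prob_space \<nu> by (rule prob_space_polymorphism) fact
  interpret n': prob_space \<nu>' by (rule prob_space_polymorphism) fact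
  fix A B assume AB: "A \<in> sets M" "B \<in> sets M"
  have "measure \<nu> (A \<times> B) = measure \<nu>' (A \<times> B)"
    by (rule LIMSEQ_unique[OF weak_limitD[OF 1 AB] weak_limitD[OF 2 AB]])
  then show "emeasure \<nu> (A \<times> B) = emeasure \<nu>' (A \<times> B)"
    by (simp add: n.emeasure_eq_measure n'.emeasure_eq_measure)
qed

lemma integral_polymorphism_snd:
  fixes h :: "'a \<Rightarrow> real"
  assumes "polymorphism M \<nu>" "h \<in> borel_measurable M"
  shows "(\<integral>z. h (snd z) \<partial>\<nu>) = (\<integral>x. h x \<partial>M)"
  using integral_distr[OF polymorphism_measurable(2)[OF assms(1)], of h] assms
  by (simp add: polymorphism_def)

lemma integrable_polymorphism_snd:
  fixes h :: "'a \<Rightarrow> real"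
  assumes "polymorphism M \<nu>" "integrable M h"
  shows "integrable \<nu> (\<lambda>z. h (snd z))"
  using integrable_distr[OF polymorphism_measurable(2)[OF assms(1)], of h] assms
  by (simp add: polymorphism_def)

lemma integrable_polymorphism_prod:
  fixes h :: "'a \<Rightarrow> real"
  assumes \<nu>: "polymorphism M \<nu>" and A: "A \<in> sets M" and h: "integrable M h"
  shows "integrable \<nu> (\<lambda>z. indicator A (fst z) * h (snd z))"
proof -
  have "fst -` A \<inter> space \<nu> \<in> sets \<nu>"
    using polymorphism_measurable(1)[OF \<nu>] A by (rule measurable_sets)
  from integrable_mult_indicator[OF this integrable_polymorphism_snd[OF \<nu> h]]
  show ?thesis
    by (rule Bochner_Integration.integrable_cong[OF refl, THEN iffD1, rotated]) (auto simp: indicator_def)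
qed

text \<open>
Convergence on rectangles extends from indicators to all integrable \<open>h\<close> in the second
variable: the common marginal \<open>M\<close> bounds the error of an approximation of \<open>h\<close> in \<open>L\<^sup>1(M)\<close>
uniformly over the whole sequence.
\<close>

lemma weak_limit_integral:
  fixes h :: "'a \<Rightarrow> real"
  assumes p: "\<And>n. polymorphism M (\<nu>s n)" and lim: "weak_limit M \<nu>s \<nu>"
    and A: "A \<in> sets M" and h: "integrable M h"
  shows "(\<lambda>n. \<integral>z. indicator A (fst z) * h (snd z) \<partial>\<nu>s n) \<longlonglongrightarrow> (\<integral>z. indicator A (fst z) * h (snd z) \<partial>\<nu>)"
  using h
proof (induction rule: integrable_induct)
  case (base B c)
  have *: "(\<integral>z. indicator A (fst z) * (indicator B (snd z) *\<^sub>R c) \<partial>\<nu>) = c * measure \<nu> (A \<times> B)"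
    if n: "polymorphism M \<nu>" for \<nu>
  proof -
    have "(\<integral>z. indicator A (fst z) * (indicator B (snd z) *\<^sub>R c) \<partial>\<nu>) = (\<integral>z. indicator (A \<times> B) z * c \<partial>\<nu>)"
      by (intro Bochner_Integration.integral_cong) (auto simp: indicator_def)
    then show ?thesis
      using A base sets.sets_into_space[of _ M]
      by (simp add: polymorphism_space[OF n] Int_absorb2 Times_Int_Times)
  qed
  show ?case
    using weak_limitD[OF lim A base(1)]
    unfolding *[OF p] *[OF weak_limit_polymorphism[OF lim]] by (rule tendsto_mult_left)
next
  case (add f g)
  have *: "(\<integral>z. indicator A (fst z) * (f (snd z) + g (snd z)) \<partial>\<nu>) =
    (\<integral>z. indicator A (fst z) * f (snd z) \<partial>\<nu>) + (\<integral>z. indicator A (fst z) * g (snd z) \<partial>\<nu>)"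
    if n: "polymorphism M \<nu>" for \<nu>
    using integrable_polymorphism_prod[OF n A] add(1,2)
    by (simp add: distrib_left add)
  show ?case
    unfolding *[OF p] *[OF weak_limit_polymorphism[OF lim]] using add by (intro tendsto_add)
next
  case (lim f s)
  let ?I = "\<lambda>\<nu> h. \<integral>z. indicator A (fst z) * h (snd z) \<partial>\<nu>"
  have conv: "(\<lambda>i. \<integral>x. \<bar>s i x - f x\<bar> \<partial>M) \<longlonglongrightarrow> (\<integral>x. 0 \<partial>M)"
  proof (rule integral_dominated_convergence)
    show "integrable M (\<lambda>x. 3 * norm (f x))"
      using lim by simp
    show "AE x in M. (\<lambda>i. \<bar>s i x - f x\<bar>) \<longlonglongrightarrow> 0"
      using lim by (auto intro!: tendsto_rabs_zero LIM_zero)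
    show "AE x in M. norm \<bar>s i x - f x\<bar> \<le> 3 * norm (f x)" for i
    proof (rule AE_I2)
      fix x assume "x \<in> space M"
      then have "norm (s i x) \<le> 2 * norm (f x)" using lim by blast
      then show "norm \<bar>s i x - f x\<bar> \<le> 3 * norm (f x)" by simp
    qed
  qed (use lim in auto)
  have bound: "\<bar>?I \<nu> (s i) - ?I \<nu> f\<bar> \<le> (\<integral>x. \<bar>s i x - f x\<bar> \<partial>M)" if n: "polymorphism M \<nu>" for \<nu> i
  proof -
    have d: "integrable M (\<lambda>x. \<bar>s i x - f x\<bar>)" using lim by simp
    have "?I \<nu> (s i) - ?I \<nu> f = (\<integral>z. indicator A (fst z) * (s i (snd z) - f (snd z)) \<partial>\<nu>)"
      using integrable_polymorphism_prod[OF n A] lim by (simp add: right_diff_distrib)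
    also have "\<bar>\<dots>\<bar> \<le> (\<integral>z. \<bar>s i (snd z) - f (snd z)\<bar> \<partial>\<nu>)"
      using integrable_polymorphism_prod[OF n A, of "\<lambda>x. s i x - f x"] lim
        integrable_polymorphism_snd[OF n d]
      by (intro order_trans[OF integral_abs_bound] integral_mono)
         (auto simp: abs_mult indicator_def intro: integrable_polymorphism_prod[OF n A d, simplified])
    also have "\<dots> = (\<integral>x. \<bar>s i x - f x\<bar> \<partial>M)"
      by (rule integral_polymorphism_snd[OF n borel_measurable_integrable[OF d]])
    finally show ?thesis .
  qed
  show ?case
  proof (rule LIMSEQ_I)
    fix e :: real assume e: "0 < e"
    obtain i where i: "(\<integral>x. \<bar>s i x - f x\<bar> \<partial>M) < e / 3"
    proof -
      have "\<forall>\<^sub>F i in sequentially. (\<integral>x. \<bar>s i x - f x\<bar> \<partial>M) < e / 3"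
        using conv e by (intro order_tendstoD) auto
      then show thesis using that by (auto simp: eventually_sequentially)
    qed
    obtain N where N: "\<And>n. n \<ge> N \<Longrightarrow> norm (?I (\<nu>s n) (s i) - ?I \<nu> (s i)) < e / 3"
      using LIMSEQ_D[OF lim.IH[of i], of "e / 3"] e by auto
    show "\<exists>N. \<forall>n\<ge>N. norm (?I (\<nu>s n) f - ?I \<nu> f) < e"
    proof (intro exI allI impI)
      fix n assume "N \<le> n"
      then show "norm (?I (\<nu>s n) f - ?I \<nu> f) < e"
        using N[of n] bound[OF p, of n i]
          bound[OF weak_limit_polymorphism[OF \<open>weak_limit M \<nu>s \<nu>\<close>], of i] i
        unfolding real_norm_def by linarith
    qed
  qed
qed

end

context disintegrable_space
begin

text \<open>
For a fixed left factor the mass of \<open>A \<times> B\<close> in the product is the integral of \<open>1\<^sub>A(x) h(y)\<close>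
against the right factor, where \<open>h(y)\<close> is the mass that the left factor sends from \<open>y\<close> to \<open>B\<close>.
Weak convergence of right factors thus carries over to the products.
\<close>

lemma weak_limit_poly_prod_left:
  assumes p: "\<And>n. polymorphism M (\<nu>s n)" and lim: "weak_limit M \<nu>s \<nu>" and \<pi>: "polymorphism M \<pi>"
  shows "weak_limit M (\<lambda>n. poly_prod M \<pi> (\<nu>s n)) (poly_prod M \<pi> \<nu>)"
  unfolding weak_limit_def
proof (intro conjI ballI)
  note p' = weak_limit_polymorphism[OF lim]
  show "polymorphism M (poly_prod M \<pi> \<nu>)"
    by (rule polymorphism_poly_prod[OF \<pi> p'])
  fix A B assume A[measurable]: "A \<in> sets M" and B[measurable]: "B \<in> sets M"
  define h where "h x = measure (cond_measure M \<pi> x) B" for x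
  have h[measurable]: "h \<in> borel_measurable M"
    unfolding h_def
    by (rule measurable_compose[OF measurable_prob_algebraD[OF cond_measure_measurable[OF \<pi>]]
          measurable_measure_subprob_algebra[OF B]])
  have pK: "prob_space (cond_measure M \<pi> x)" "sets (cond_measure M \<pi> x) = sets M" if "x \<in> space M" for x
    using measurable_space[OF cond_measure_measurable[OF \<pi>] that] by (auto simp: space_prob_algebra)
  have h01: "h x \<ge> 0" "x \<in> space M \<Longrightarrow> h x \<le> 1" for x
    using prob_space.prob_le_1[OF pK(1)] by (auto simp: h_def)
  have hi: "integrable M h"
    by (rule integrable_const_bound[of _ 1]) (auto simp: h01)
  have hm: "AE x in M. markov M \<pi> (indicator B) x = ennreal (h x)"
  proof (rule AE_I2)
    fix x assume x: "x \<in> space M"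
    interpret K: prob_space "cond_measure M \<pi> x" by (rule pK[OF x])
    show "markov M \<pi> (indicator B) x = ennreal (h x)"
      using pK(2)[OF x] B by (simp add: markov_def h_def K.emeasure_eq_measure)
  qed
  have *: "measure (poly_prod M \<pi> \<nu>) (A \<times> B) = (\<integral>z. indicator A (fst z) * h (snd z) \<partial>\<nu>)"
    if n: "polymorphism M \<nu>" for \<nu>
  proof -
    have "emeasure (poly_prod M \<pi> \<nu>) (A \<times> B) = (\<integral>\<^sup>+z. indicator A (fst z) * ennreal (h (snd z)) \<partial>\<nu>)"
      by (rule emeasure_poly_prod_Times[OF \<pi> n A B hm])
    also have "\<dots> = (\<integral>\<^sup>+z. ennreal (indicator A (fst z) * h (snd z)) \<partial>\<nu>)"
      by (intro nn_integral_cong) (auto simp: indicator_def)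
    also have "\<dots> = ennreal (\<integral>z. indicator A (fst z) * h (snd z) \<partial>\<nu>)"
      by (rule nn_integral_eq_integral[OF integrable_polymorphism_prod[OF n A hi]])
         (auto simp: h01 indicator_def)
    finally show ?thesis
      by (simp add: measure_def h01 integral_nonneg_AE)
  qed
  show "(\<lambda>n. measure (poly_prod M \<pi> (\<nu>s n)) (A \<times> B)) \<longlonglongrightarrow> measure (poly_prod M \<pi> \<nu>) (A \<times> B)"
    unfolding *[OF p] *[OF p'] by (rule weak_limit_integral[OF p lim A hi])
qed

lemma weak_limit_poly_prod_right:
  assumes p: "\<And>n. polymorphism M (\<nu>s n)" and lim: "weak_limit M \<nu>s \<nu>" and \<pi>: "polymorphism M \<pi>"
  shows "weak_limit M (\<lambda>n. poly_prod M (\<nu>s n) \<pi>) (poly_prod M \<nu> \<pi>)"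
proof -
  note p' = weak_limit_polymorphism[OF lim]
  have "weak_limit M (\<lambda>n. poly_prod M (conjugate M \<pi>) (conjugate M (\<nu>s n)))
      (poly_prod M (conjugate M \<pi>) (conjugate M \<nu>))"
    by (intro weak_limit_poly_prod_left weak_limit_conjugate polymorphism_conjugate p lim \<pi>)
  then have "weak_limit M (\<lambda>n. conjugate M (poly_prod M (\<nu>s n) \<pi>)) (conjugate M (poly_prod M \<nu> \<pi>))"
    by (simp add: conjugate_poly_prod p p' \<pi>)
  from weak_limit_conjugate[OF _ this]
  have "weak_limit M (\<lambda>n. conjugate M (conjugate M (poly_prod M (\<nu>s n) \<pi>)))
      (conjugate M (conjugate M (poly_prod M \<nu> \<pi>)))"
    by (simp add: polymorphism_conjugate polymorphism_poly_prod p \<pi>)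
  then show ?thesis
    unfolding conjugate_conjugate[OF polymorphism_poly_prod[OF p \<pi>]]
      conjugate_conjugate[OF polymorphism_poly_prod[OF p' \<pi>]] .
qed

lemma polymorphism_poly_power:
  "polymorphism M \<nu> \<Longrightarrow> polymorphism M (poly_power M \<nu> n)"
  by (induction n) (auto intro: polymorphism_poly_prod polymorphism_poly_of_map preserves_measure_id)

lemma poly_power_commute:
  assumes "polymorphism M \<nu>"
  shows "poly_prod M (poly_power M \<nu> n) \<nu> = poly_prod M \<nu> (poly_power M \<nu> n)"
proof (induction n)
  case 0
  then show ?case by (simp add: poly_prod_id_left poly_prod_id_right assms)
next
  case (Suc n)
  then show ?case
    by (simp add: poly_prod_assoc polymorphism_poly_power assms)
qed

end

section \<open>The intertwining relations\<close>

lemma inverse_mod0_aut_inv: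
  "automorphism M T \<Longrightarrow> inverse_mod0 M T (aut_inv M T)"
  unfolding automorphism_def aut_inv_def by (elim conjE) (rule someI_ex[of "inverse_mod0 M T"])

text \<open>
The inverse mod 0 is required only to be measurable; it preserves the measure because
\<open>S \<circ> T\<close> is the identity almost everywhere.
\<close>

lemma preserves_measure_aut_inv:
  assumes T: "automorphism M T"
  shows "preserves_measure M (aut_inv M T)"
proof -
  define S where "S = aut_inv M T"
  have S[measurable]: "S \<in> measurable M M" and ST: "AE x in M. S (T x) = x"
    using inverse_mod0_aut_inv[OF T] by (auto simp: inverse_mod0_def S_def)
  have Tm[measurable]: "T \<in> measurable M M" and d: "distr M M T = M"
    using T by (auto simp: automorphism_def)
  have "distr M M S = distr (distr M M T) M S"
    by (simp add: d)
  also have "\<dots> = distr M M (S \<circ> T)"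
    by (rule distr_distr) measurable
  also have "\<dots> = distr M M (\<lambda>x. x)"
    using ST by (intro distr_cong_AE) auto
  finally show ?thesis
    using S by (simp add: preserves_measure_def distr_id2 S_def)
qed

context disintegrable_space
begin

text \<open>
Shifting the index by one changes each approximating sequence by a factor on either side:
\<open>P (P\<^sup>n T\<^bsup>-n\<^esup>) = (P\<^bsup>n+1\<^esup> T\<^bsup>-n-1\<^esup>) T\<close> and \<open>(T\<^bsup>-n\<^esup> P\<^sup>n) P = T (T\<^bsup>-n-1\<^esup> P\<^bsup>n+1\<^esup>)\<close>. Both relations
survive in the limit by separate continuity of the product.
\<close>

lemma weak_limits_intertwine:
  assumes T: "automorphism M T" and P: "polymorphism M P"
  shows "weak_limit M (\<lambda>n. poly_prod M (poly_power M P n) (poly_of_map M (aut_inv M T ^^ n))) \<Lambda>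
      \<Longrightarrow> poly_prod M P \<Lambda> = poly_prod M \<Lambda> (poly_of_map M T)" (is "weak_limit M ?l \<Lambda> \<Longrightarrow> _")
    and "weak_limit M (\<lambda>n. poly_prod M (poly_of_map M (aut_inv M T ^^ n)) (poly_power M P n)) \<Gamma>
      \<Longrightarrow> poly_prod M \<Gamma> P = poly_prod M (poly_of_map M T) \<Gamma>" (is "weak_limit M ?g \<Gamma> \<Longrightarrow> _")
proof -
  define S where "S = aut_inv M T"
  have mT: "preserves_measure M T"
    using T by (simp add: automorphism_def preserves_measure_def)
  have mS: "preserves_measure M S"
    unfolding S_def by (rule preserves_measure_aut_inv[OF T])
  have mSn: "preserves_measure M (S ^^ n)" for n
    by (rule preserves_measure_funpow[OF mS])
  have inv: "AE x in M. S (T x) = x" "AE x in M. T (S x) = x"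
    using inverse_mod0_aut_inv[OF T] by (auto simp: inverse_mod0_def S_def)
  note pT = polymorphism_poly_of_map[OF mT] and pSn = polymorphism_poly_of_map[OF mSn]
    and pP = polymorphism_poly_power[OF P]
  note pp = polymorphism_poly_prod
  have cancel: "poly_prod M (poly_of_map M (S ^^ Suc n)) (poly_of_map M T) = poly_of_map M (S ^^ n)"
    "poly_prod M (poly_of_map M T) (poly_of_map M (S ^^ Suc n)) = poly_of_map M (S ^^ n)" for n
  proof -
    show "poly_prod M (poly_of_map M (S ^^ Suc n)) (poly_of_map M T) = poly_of_map M (S ^^ n)"
      using inv(1) by (intro poly_prod_poly_of_map mT mSn) (auto simp: funpow_swap1)
    have m: "S ^^ n \<in> measurable M M" "distr M M (S ^^ n) = M"
      using mSn by (auto simp: preserves_measure_def)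
    have "AE x in distr M M (S ^^ n). T (S x) = x"
      using inv(2) by (simp only: m(2))
    then have "AE x in M. T (S ((S ^^ n) x)) = (S ^^ n) x"
      by (rule AE_distrD[OF m(1)])
    then show "poly_prod M (poly_of_map M T) (poly_of_map M (S ^^ Suc n)) = poly_of_map M (S ^^ n)"
      by (intro poly_prod_poly_of_map mT mSn) auto
  qed
  show "poly_prod M P \<Lambda> = poly_prod M \<Lambda> (poly_of_map M T)" if "weak_limit M ?l \<Lambda>"
  proof (rule weak_limit_unique)
    let ?l' = "\<lambda>n. poly_prod M (poly_power M P n) (poly_of_map M (S ^^ n))"
    have l: "weak_limit M ?l' \<Lambda>" using that by (simp add: S_def)
    have pl: "polymorphism M (?l' n)" for n by (intro pp pP pSn)
    have eq: "poly_prod M P (?l' n) = poly_prod M (?l' (Suc n)) (poly_of_map M T)" for n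
    proof -
      have "poly_prod M (?l' (Suc n)) (poly_of_map M T)
          = poly_prod M (poly_power M P (Suc n)) (poly_of_map M (S ^^ n))"
        by (simp only: poly_prod_assoc[OF pP pSn pT] cancel)
      also have "\<dots> = poly_prod M P (?l' n)"
        by (simp add: poly_prod_assoc[OF P pP pSn])
      finally show ?thesis ..
    qed
    show "weak_limit M (\<lambda>n. poly_prod M P (?l' n)) (poly_prod M \<Lambda> (poly_of_map M T))"
      unfolding eq by (rule weak_limit_poly_prod_right[OF pl weak_limit_Suc[OF l] pT])
    show "weak_limit M (\<lambda>n. poly_prod M P (?l' n)) (poly_prod M P \<Lambda>)"
      by (rule weak_limit_poly_prod_left[OF pl l P])
  qed
  show "poly_prod M \<Gamma> P = poly_prod M (poly_of_map M T) \<Gamma>" if "weak_limit M ?g \<Gamma>"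
  proof (rule weak_limit_unique)
    let ?g' = "\<lambda>n. poly_prod M (poly_of_map M (S ^^ n)) (poly_power M P n)"
    have l: "weak_limit M ?g' \<Gamma>" using that by (simp add: S_def)
    have pg: "polymorphism M (?g' n)" for n by (intro pp pP pSn)
    have eq: "poly_prod M (?g' n) P = poly_prod M (poly_of_map M T) (?g' (Suc n))" for n
    proof -
      have "poly_prod M (poly_of_map M T) (?g' (Suc n))
          = poly_prod M (poly_of_map M (S ^^ n)) (poly_power M P (Suc n))"
        by (simp only: poly_prod_assoc[OF pT pSn pP, symmetric] cancel)
      also have "\<dots> = poly_prod M (?g' n) P"
        by (simp add: poly_prod_assoc[OF pSn pP P] poly_power_commute[OF P])
      finally show ?thesis ..
    qed
    show "weak_limit M (\<lambda>n. poly_prod M (?g' n) P) (poly_prod M (poly_of_map M T) \<Gamma>)"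
      unfolding eq by (rule weak_limit_poly_prod_left[OF pg weak_limit_Suc[OF l] pT])
    show "weak_limit M (\<lambda>n. poly_prod M (?g' n) P) (poly_prod M \<Gamma> P)"
      by (rule weak_limit_poly_prod_right[OF pg l P])
  qed
qed

end

theorem theorem1:
  fixes M :: "'a measure" and T :: "'a \<Rightarrow> 'a" and R :: "('a \<times> 'a) set"
    and \<Phi> P \<Lambda> \<Gamma> :: "('a \<times> 'a) measure"
  assumes "lebesgue_space M"
    and "automorphism M T" and "ergodic_map M T"
    and "equiv (space M) R" and "invariant_rel M T R" and "ergodic_rel M R"
    and "polymorphism M \<Phi>" and "nondegenerate M \<Phi>" and "associated M R \<Phi>"
    and "P = poly_prod M \<Phi> (poly_of_map M T)"
    and "weak_limit M
           (\<lambda>n. poly_prod M (poly_power M P n) (poly_of_map M (aut_inv M T ^^ n))) \<Lambda>"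
    and "weak_limit M
           (\<lambda>n. poly_prod M (poly_of_map M (aut_inv M T ^^ n)) (poly_power M P n)) \<Gamma>"
    and "dense_poly M \<Lambda>" and "dense_poly M \<Gamma>"
  shows "poly_prod M P \<Lambda> = poly_prod M \<Lambda> (poly_of_map M T)
       \<and> poly_prod M \<Gamma> P = poly_prod M (poly_of_map M T) \<Gamma>
       \<and> quasi_similar M (poly_of_map M T) P"
proof -
  interpret prob_space M
    using assms(1) by (simp add: lebesgue_space_def)
  interpret disintegrable_space M
    by unfold_locales (rule lebesgue_space_disintegration[OF assms(1)])
  have "preserves_measure M T"
    using assms(2) by (simp add: automorphism_def preserves_measure_def)
  then have P: "polymorphism M P"
    unfolding assms(10) by (intro polymorphism_poly_prod assms(7) polymorphism_poly_of_map)
  have \<Lambda>: "poly_prod M P \<Lambda> = poly_prod M \<Lambda> (poly_of_map M T)"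
    by (rule weak_limits_intertwine(1)[OF assms(2) P assms(11)])
  have \<Gamma>: "poly_prod M \<Gamma> P = poly_prod M (poly_of_map M T) \<Gamma>"
    by (rule weak_limits_intertwine(2)[OF assms(2) P assms(12)])
  have "quasi_image M (poly_of_map M T) P"
    unfolding quasi_image_def
    by (intro exI[of _ \<Lambda>] conjI weak_limit_polymorphism[OF assms(11)] assms(13) \<Lambda>[symmetric])
  moreover have "quasi_image M P (poly_of_map M T)"
    unfolding quasi_image_def
    by (intro exI[of _ \<Gamma>] conjI weak_limit_polymorphism[OF assms(12)] assms(14) \<Gamma>)
  ultimately show ?thesis
    using \<Lambda> \<Gamma> by (simp add: quasi_similar_def)
qed

end
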